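(* Let $r\geq 3$ be fixed. For a prime power $q$ and $p=p(q)\in[0,1]$, let $\mathcal{H}_q(p)$ be the random $3$-uniform hypergraph obtained by including each point of $\mathrm{PG}(r,q)$ independently with probability $p$ and taking as hyperedges the collinear triples among the chosen points; let $\alpha(\mathcal{H}_q(p))$ be the maximum size of a set of chosen points no three of which are collinear. Then asymptotically almost surely (with probability tending to $1$ as $q\to\infty$): (a) $\alpha(\mathcal{H}_q(p))=(1+o(1))pq^r$ if $q^{-r}\ll p\ll q^{-(r+1)/2}$; (b) $\alpha(\mathcal{H}_q(p))=O(q^{(r-1)/2}\ln^2 q)$ if $q^{-(r+1)/2}\leq p\leq q^{-(r-1)/2}\ln^2 q$; (c) $\alpha(\mathcal{H}_q(p))=O(pq^{r-1})$ if $q^{-(r-1)/2}\ln^2 q\leq p\leq 1$; (d) $\alpha(\mathcal{H}_q(p))=\Omega(q^{(r-1)/2}/\ln q)$ if $q^{-(r+1)/2}/\ln q\leq p\leq 1$; (e) if $r=3$, then $\alpha(\mathcal{H}_q(p))=\Omega(pq^{r-1})$ whenever $q^{-(r-1)/2}\ln q\ll p\leq 1$.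
   Context: For non-negative functions, $f\ll g$ means $f=o(g)$ as $q\to\infty$. The implied constants in $O$ and $\Omega$ do not depend on $q$ or $p$. *)

theory Defs
  imports
    "HOL-Probability.Probability"
    "HOL-Number_Theory.Prime_Powers"
    "HOL-Library.Landau_Symbols"
    "Jordan_Normal_Form.Missing_VectorSpace"
begin

section \<open>The projective space of dimension \<open>r\<close> over a field\<close>

text \<open>
  The projective space is built from the vector space of dimension \<open>r + 1\<close>, whose coordinates
  are indexed by \<open>0, \<dots>, r\<close>. Projective dimension is vector space dimension minus one.
\<close>

abbreviation coord_space :: "'a ring \<Rightarrow> nat \<Rightarrow> ('a, nat \<Rightarrow> 'a) module" where
  "coord_space K r \<equiv> LinearCombinations.ring.func_space K {..r}"

definition pg_subspaces :: "'a ring \<Rightarrow> nat \<Rightarrow> nat \<Rightarrow> (nat \<Rightarrow> 'a) set set" where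
  "pg_subspaces K r d =
     {W. subspace K W (coord_space K r) \<and>
         vectorspace.dim K ((coord_space K r)\<lparr>carrier := W\<rparr>) = d + 1}"

abbreviation pg_points :: "'a ring \<Rightarrow> nat \<Rightarrow> (nat \<Rightarrow> 'a) set set" where
  "pg_points K r \<equiv> pg_subspaces K r 0"

abbreviation pg_lines :: "'a ring \<Rightarrow> nat \<Rightarrow> (nat \<Rightarrow> 'a) set set" where
  "pg_lines K r \<equiv> pg_subspaces K r 1"

definition pg_collinear :: "'a ring \<Rightarrow> nat \<Rightarrow> (nat \<Rightarrow> 'a) set set \<Rightarrow> bool" where
  "pg_collinear K r T \<longleftrightarrow> (\<exists>L \<in> pg_lines K r. \<forall>P \<in> T. P \<subseteq> L)"


section \<open>Hypergraphs of collinear triples\<close>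

type_synonym 'v hypergraph = "'v set \<times> 'v set set"

text \<open>Meaningful for hypergraphs with a finite vertex set only.\<close>

definition independence_number :: "'v hypergraph \<Rightarrow> nat" where
  "independence_number H = Max (card ` {I. I \<subseteq> fst H \<and> (\<forall>e \<in> snd H. \<not> e \<subseteq> I)})"

definition collinear_triples :: "'a ring \<Rightarrow> nat \<Rightarrow> (nat \<Rightarrow> 'a) set set \<Rightarrow> (nat \<Rightarrow> 'a) set hypergraph"
  where
  "collinear_triples K r S = (S, {T. T \<subseteq> S \<and> card T = 3 \<and> pg_collinear K r T})"

definition random_collinear_triples ::
    "'a ring \<Rightarrow> nat \<Rightarrow> real \<Rightarrow> (nat \<Rightarrow> 'a) set hypergraph pmf" where
  "random_collinear_triples K r p =
     map_pmf (\<lambda>f. collinear_triples K r {x \<in> pg_points K r. f x})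
       (Pi_pmf (pg_points K r) False (\<lambda>_. bernoulli_pmf p))"


section \<open>Asymptotics along the prime powers\<close>

definition primepow_at_top :: "nat filter" where
  "primepow_at_top = inf at_top (principal {q. primepow q})"

definition aas :: "(nat \<Rightarrow> 'b pmf) \<Rightarrow> (nat \<Rightarrow> 'b \<Rightarrow> bool) \<Rightarrow> bool" where
  "aas M E \<longleftrightarrow> ((\<lambda>q. measure_pmf.prob (M q) {x. E q x}) \<longlongrightarrow> 1) primepow_at_top"

definition prob_function :: "(nat \<Rightarrow> real) \<Rightarrow> bool" where
  "prob_function p \<longleftrightarrow> (\<forall>q. primepow q \<longrightarrow> 0 \<le> p q \<and> p q \<le> 1)"

definition much_less :: "(nat \<Rightarrow> real) \<Rightarrow> (nat \<Rightarrow> real) \<Rightarrow> bool"  (infix \<open>\<lless>\<close> 50) where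
  "f \<lless> g \<longleftrightarrow> f \<in> o[primepow_at_top](g)"

end

theory Submission
  imports Defs "HOL-Algebra.Multiplicative_Group" "HOL-Real_Asymp.Real_Asymp"
begin

text \<open>
  For the upper bounds, fix a cap \<open>I\<close> and a \<open>t\<close>-subset \<open>T\<close> of it, and join two points by an edge if
  they are collinear with a point of \<open>T\<close>. The rest of \<open>I\<close> is independent in this graph. Since \<open>T\<close>
  is a cap, every edge arises from at most two points of \<open>T\<close>; hence, by Cauchy--Schwarz on the
  pencil of each point of \<open>T\<close>, every set of more than \<open>4 q\<^bsup>r-1\<^esup>\<close> points outside \<open>T\<close> contains a
  vertex joined to a proportion of at least \<open>t / (8 q\<^bsup>r-1\<^esup>)\<close> of the set. The Kleitman--Winston
  argument then bounds the number of independent sets, and a first moment computation over all caps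
  of a given size suffices with \<open>t\<close> of order \<open>q\<^bsup>(r-1)/2\<^esup> ln q\<close>.

  For the lower bounds, below \<open>q\<^bsup>-(r+1)/2\<^esup>\<close> the collinear triples are so few that deleting a point
  from each of them costs nothing; larger \<open>p\<close> follow by monotonicity. In dimension three a
  deterministic elliptic quadric meets the random set in about \<open>p q\<^sup>2\<close> points.
\<close>

section \<open>Random subsets\<close>

text \<open>A first moment over all \<open>m\<close>-subsets of the points, caps or not, diverges,
  so a cap must be described by few free choices. One branching step shrinks the candidates by a
  factor \<open>exp (- t / (4 * pencil_size))\<close>; descending from about \<open>q^r\<close>
  points to about \<open>q^(r-1)\<close> therefore takes \<open>s\<close> of order
  \<open>q^(r-1) ln q / t\<close> steps. Each of the \<open>t + s\<close> choices costs a factor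
  polynomial in \<open>q\<close>. Balancing \<open>s = t\<close> explains the square root in
  \<open>q^((r-1)/2)\<close>, and the total cost \<open>exp (O(t ln q))\<close> explains the second
  logarithm in (b). The roughly \<open>q^(r-1)\<close> candidates left at the end are chosen freely
  and contribute \<open>exp (O(p q^(r-1)))\<close>, the term that dominates in (c). Hence (b) and
  (c) are one estimate read at two ranges of \<open>p\<close>.

  The threshold \<open>q^(-(r+1)/2)\<close> is where the number of collinear triples, of order
  \<open>p^3 q^(2r+1)\<close>, catches up with the number \<open>p q^r\<close> of points. For (d),
  dividing this density by \<open>ln q\<close> puts it just inside the range of (a), which is the
  origin of the logarithm there.\<close>

definition random_subset :: "'b set \<Rightarrow> real \<Rightarrow> 'b set pmf" where
  "random_subset V p = map_pmf (\<lambda>f. {x \<in> V. f x}) (Pi_pmf V False (\<lambda>_. bernoulli_pmf p))"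

lemma set_random_subset: "S \<in> set_pmf (random_subset V p) \<Longrightarrow> S \<subseteq> V"
  by (auto simp: random_subset_def)

lemma finite_set_random_subset: "finite V \<Longrightarrow> finite (set_pmf (random_subset V p))"
  by (rule finite_subset[of _ "Pow V"]) (auto dest: set_random_subset)

lemma prob_random_subset_superset:
  assumes "finite V" "T \<subseteq> V" "0 \<le> p" "p \<le> 1"
  shows "measure_pmf.prob (random_subset V p) {S. T \<subseteq> S} = p ^ card T"
proof -
  let ?P = "Pi_pmf V False (\<lambda>_. bernoulli_pmf p)"
  have "measure_pmf.prob (random_subset V p) {S. T \<subseteq> S} =
      measure_pmf.prob ?P (Pi V (\<lambda>x. if x \<in> T then {True} else UNIV))"
    unfolding random_subset_def measure_map_pmf using assms(2)
    by (intro arg_cong[where f = "measure_pmf.prob ?P"]) (auto simp: Pi_def split: if_splits)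
  also have "\<dots> = (\<Prod>x\<in>V. measure_pmf.prob (bernoulli_pmf p) (if x \<in> T then {True} else UNIV))"
    by (rule measure_Pi_pmf_Pi[OF assms(1)])
  also have "\<dots> = (\<Prod>x\<in>V. if x \<in> T then p else 1)"
    using assms(3,4) by (intro prod.cong) (auto simp: measure_pmf_single)
  also have "\<dots> = p ^ card T"
    using assms(1,2) by (simp add: prod.If_cases inf_absorb2)
  finally show ?thesis .
qed

lemma prob_random_subset_ex_le:
  assumes "finite V" "F \<subseteq> Pow V" "0 \<le> p" "p \<le> 1"
  shows "measure_pmf.prob (random_subset V p) {S. \<exists>T\<in>F. T \<subseteq> S} \<le> (\<Sum>T\<in>F. p ^ card T)"
proof -
  have "finite F" using assms by (metis finite_Pow_iff finite_subset)
  have "{S. \<exists>T\<in>F. T \<subseteq> S} = (\<Union>T\<in>F. {S. T \<subseteq> S})" by auto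
  hence "measure_pmf.prob (random_subset V p) {S. \<exists>T\<in>F. T \<subseteq> S}
      \<le> (\<Sum>T\<in>F. measure_pmf.prob (random_subset V p) {S. T \<subseteq> S})"
    using \<open>finite F\<close> by (simp add: measure_pmf.finite_measure_subadditive_finite)
  also have "\<dots> = (\<Sum>T\<in>F. p ^ card T)"
    using assms by (intro sum.cong) (auto intro!: prob_random_subset_superset)
  finally show ?thesis .
qed

lemma expectation_card_contained:
  assumes "finite V" "F \<subseteq> Pow V" "0 \<le> p" "p \<le> 1"
  shows "measure_pmf.expectation (random_subset V p) (\<lambda>S. real (card {T \<in> F. T \<subseteq> S})) =
    (\<Sum>T\<in>F. p ^ card T)"
proof -
  have "finite F" using assms by (metis finite_Pow_iff finite_subset)
  note int = integrable_measure_pmf_finite[OF finite_set_random_subset[OF assms(1), of p]]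
  have "real (card {T \<in> F. T \<subseteq> S}) = (\<Sum>T\<in>F. indicator {S. T \<subseteq> S} S)" for S
    unfolding indicator_def of_bool_def using \<open>finite F\<close>
    by (subst sum.If_cases) (auto intro!: arg_cong[where f = card])
  hence "measure_pmf.expectation (random_subset V p) (\<lambda>S. real (card {T \<in> F. T \<subseteq> S})) =
      measure_pmf.expectation (random_subset V p) (\<lambda>S. \<Sum>T\<in>F. indicator {S. T \<subseteq> S} S)"
    by presburger
  also have "\<dots> = (\<Sum>T\<in>F. measure_pmf.expectation (random_subset V p) (indicator {S. T \<subseteq> S}))"
    by (rule Bochner_Integration.integral_sum) (rule int)
  also have "\<dots> = (\<Sum>T\<in>F. p ^ card T)"
  proof (intro sum.cong refl)
    fix T assume "T \<in> F"
    hence "T \<subseteq> V" using assms(2) by auto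
    thus "measure_pmf.expectation (random_subset V p) (indicator {S. T \<subseteq> S}) = p ^ card T"
      using prob_random_subset_superset[of V T p] assms by simp
  qed
  finally show ?thesis .
qed

text \<open>Markov's inequality for the number of members of \<open>F\<close> inside the random set;
  it will control the collinear triples.\<close>

lemma prob_card_contained_ge:
  assumes "finite V" "F \<subseteq> Pow V" "0 \<le> p" "p \<le> 1" "0 < c" "\<And>T. T \<in> F \<Longrightarrow> card T = k"
  shows "measure_pmf.prob (random_subset V p) {S. c \<le> real (card {T \<in> F. T \<subseteq> S})}
    \<le> real (card F) * p ^ k / c"
proof -
  have "measure_pmf.prob (random_subset V p) {S. c \<le> real (card {T \<in> F. T \<subseteq> S})}
    \<le> measure_pmf.expectation (random_subset V p) (\<lambda>S. real (card {T \<in> F. T \<subseteq> S})) / c"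
    using integral_Markov_inequality_measure[where M = "measure_pmf (random_subset V p)" and A = "{}"
        and u = "\<lambda>S. real (card {T \<in> F. T \<subseteq> S})" and c = c] assms
    by (simp add: integrable_measure_pmf_finite finite_set_random_subset)
  thus ?thesis using assms by (simp add: expectation_card_contained)
qed

text \<open>Chebyshev's inequality: the intersection size is binomial, so its variance is at most
  its mean.\<close>

lemma prob_card_Int_deviation:
  assumes "finite V" "A \<subseteq> V" "0 \<le> p" "p \<le> 1" "0 < d"
  shows "measure_pmf.prob (random_subset V p) {S. d \<le> \<bar>real (card (S \<inter> A)) - p * real (card A)\<bar>}
    \<le> p * real (card A) / d\<^sup>2"
proof -
  let ?M = "random_subset V p"
  let ?X = "\<lambda>S. real (card (S \<inter> A))"
  let ?a = "real (card A)"
  have fA: "finite A" using assms by (auto intro: finite_subset)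
  note int = integrable_measure_pmf_finite[OF finite_set_random_subset[OF assms(1), of p]]
  have X: "?X S = (\<Sum>x\<in>A. indicator {S. {x} \<subseteq> S} S)" for S
    using fA by (simp add: indicator_def sum.If_cases Int_commute)
  have P: "measure_pmf.expectation ?M (indicator {S. T \<subseteq> S}) = p ^ card T" if "T \<subseteq> A" for T
    using prob_random_subset_superset[of V T p] that assms by simp
  have "measure_pmf.expectation ?M ?X = (\<Sum>x\<in>A. measure_pmf.expectation ?M (indicator {S. {x} \<subseteq> S}))"
    unfolding X by (rule Bochner_Integration.integral_sum) (rule int)
  also have "\<dots> = (\<Sum>x\<in>A. p ^ card {x})"
    by (intro sum.cong refl P) auto
  finally have E: "measure_pmf.expectation ?M ?X = p * ?a" by simp
  \<comment> \<open>The square is expanded over ordered pairs; for \<open>x = y\<close> the set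
    \<open>{x,y}\<close> is a singleton, so the diagonal contributes \<open>p\<close> and not
    \<open>p^2\<close>.\<close>
  have X2: "(?X S)\<^sup>2 = (\<Sum>x\<in>A. \<Sum>y\<in>A. indicator {S. {x,y} \<subseteq> S} S)" for S
    unfolding X power2_eq_square sum_product by (intro sum.cong) (auto simp: indicator_def)
  have "measure_pmf.expectation ?M (\<lambda>S. (?X S)\<^sup>2) =
      (\<Sum>x\<in>A. measure_pmf.expectation ?M (\<lambda>S. \<Sum>y\<in>A. indicator {S. {x,y} \<subseteq> S} S))"
    unfolding X2 by (rule Bochner_Integration.integral_sum) (rule int)
  also have "\<dots> = (\<Sum>x\<in>A. \<Sum>y\<in>A. measure_pmf.expectation ?M (indicator {S. {x,y} \<subseteq> S}))"
    by (intro sum.cong refl Bochner_Integration.integral_sum int)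
  also have "\<dots> = (\<Sum>x\<in>A. \<Sum>y\<in>A. p ^ card {x,y})"
    by (intro sum.cong refl P) auto
  also have "\<dots> \<le> (\<Sum>x\<in>A. p * ?a * p + p)"
  proof (intro sum_mono)
    fix x assume x: "x \<in> A"
    have "(\<Sum>y\<in>A. p ^ card {x,y}) = p + (\<Sum>y\<in>A-{x}. p ^ card {x,y})"
      using x fA by (simp add: sum.remove)
    also have "(\<Sum>y\<in>A-{x}. p ^ card {x,y}) = (\<Sum>y\<in>A-{x}. p\<^sup>2)"
      by (intro sum.cong) (auto simp: card_insert_if power2_eq_square)
    also have "\<dots> \<le> (\<Sum>y\<in>A. p\<^sup>2)"
      using fA by (intro sum_mono2) auto
    finally show "(\<Sum>y\<in>A. p ^ card {x,y}) \<le> p * ?a * p + p"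
      by (simp add: power2_eq_square algebra_simps)
  qed
  finally have E2: "measure_pmf.expectation ?M (\<lambda>S. (?X S)\<^sup>2) \<le> (p * ?a)\<^sup>2 + p * ?a"
    by (simp add: power2_eq_square algebra_simps)
  have "measure_pmf.variance ?M ?X = measure_pmf.expectation ?M (\<lambda>S. (?X S)\<^sup>2) - (p * ?a)\<^sup>2"
    by (subst measure_pmf.variance_eq) (auto simp: int E)
  hence var: "measure_pmf.variance ?M ?X \<le> p * ?a" using E2 by simp
  have "measure_pmf.prob ?M {S. d \<le> \<bar>?X S - p * ?a\<bar>} \<le> measure_pmf.variance ?M ?X / d\<^sup>2"
    using measure_pmf.Chebyshev_inequality[of ?X ?M d] assms(5) by (simp add: int E)
  also have "\<dots> \<le> p * ?a / d\<^sup>2" using var by (intro divide_right_mono) auto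
  finally show ?thesis .
qed

text \<open>Thinning a \<open>p'\<close>-random set by independent coins of bias \<open>p / p'\<close> gives a \<open>p\<close>-random set.\<close>

lemma prob_random_subset_mono:
  assumes "finite V" "0 \<le> p" "p \<le> p'" "p' \<le> 1"
    and mono: "\<And>S S'. S \<subseteq> S' \<Longrightarrow> S' \<subseteq> V \<Longrightarrow> E S \<Longrightarrow> E S'"
  shows "measure_pmf.prob (random_subset V p) {S. E S} \<le> measure_pmf.prob (random_subset V p') {S. E S}"
proof (cases "p' = 0")
  case False
  define c where "c = p / p'"
  have c: "0 \<le> c" "c \<le> 1" "p' * c = p" "p' > 0" using assms False by (auto simp: c_def)
  let ?coin = "\<lambda>b. map_pmf (\<lambda>d. b \<and> d) (bernoulli_pmf c)"
  have "bernoulli_pmf p = bernoulli_pmf p' \<bind> ?coin"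
  proof (rule pmf_eqI)
    fix b
    have "pmf (map_pmf (\<lambda>d. b' \<and> d) (bernoulli_pmf c)) b =
       (if b' then pmf (bernoulli_pmf c) b else indicator {False} b)" for b'
      by (cases b'; cases b) (auto simp: map_pmf_const indicator_def)
    thus "pmf (bernoulli_pmf p) b = pmf (bernoulli_pmf p' \<bind> ?coin) b"
      using assms(2-4) c by (cases b) (simp_all add: pmf_bind algebra_simps)
  qed
  hence "random_subset V p = map_pmf (\<lambda>f. {x \<in> V. f x}) (Pi_pmf V False (\<lambda>_. bernoulli_pmf p' \<bind> ?coin))"
    by (simp add: random_subset_def)
  also have "\<dots> = Pi_pmf V False (\<lambda>_. bernoulli_pmf p') \<bind>
      (\<lambda>f. map_pmf (\<lambda>f. {x \<in> V. f x}) (Pi_pmf V False (\<lambda>x. ?coin (f x))))"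
    by (subst Pi_pmf_bind[OF assms(1), where d' = False]) (simp add: map_bind_pmf)
  finally have eq: "random_subset V p = Pi_pmf V False (\<lambda>_. bernoulli_pmf p') \<bind>
      (\<lambda>f. map_pmf (\<lambda>f. {x \<in> V. f x}) (Pi_pmf V False (\<lambda>x. ?coin (f x))))" .
  let ?N = "\<lambda>f. map_pmf (\<lambda>f. {x \<in> V. f x}) (Pi_pmf V False (\<lambda>x. ?coin (f x)))"
  \<comment> \<open>A thinned set lies inside the set it came from, so by monotonicity
    \<open>E\<close> can hold after thinning only if it held before.\<close>
  have sub: "S \<subseteq> {x \<in> V. f x}" if "S \<in> set_pmf (?N f)" for S f
    using that set_Pi_pmf_subset'[OF assms(1), of False "\<lambda>x. ?coin (f x)"]
    by (fastforce simp: PiE_dflt_def)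
  have "emeasure (random_subset V p) {S. E S} =
     (\<integral>\<^sup>+f. emeasure (?N f) {S. E S} \<partial>Pi_pmf V False (\<lambda>_. bernoulli_pmf p'))"
    unfolding eq by simp
  also have "\<dots> \<le> (\<integral>\<^sup>+f. indicator {f. E {x \<in> V. f x}} f \<partial>Pi_pmf V False (\<lambda>_. bernoulli_pmf p'))"
  proof (intro nn_integral_mono)
    fix f
    show "emeasure (?N f) {S. E S} \<le> indicator {f. E {x \<in> V. f x}} f"
    proof (cases "E {x \<in> V. f x}")
      case False
      hence "set_pmf (?N f) \<inter> {S. E S} = {}"
        using sub mono[of _ "{x \<in> V. f x}"] by blast
      hence "measure_pmf.prob (?N f) {S. E S} = 0" by (rule measure_pmf_zero_iff[THEN iffD2])
      thus ?thesis by (simp only: measure_pmf.emeasure_eq_measure) simp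
    qed (simp add: measure_pmf.emeasure_le_1)
  qed
  also have "\<dots> = emeasure (random_subset V p') {S. E S}"
    by (simp add: random_subset_def vimage_def)
  finally show ?thesis by (simp add: measure_pmf.emeasure_eq_measure)
qed (use assms in auto)

section \<open>Independent sets in graphs with large degrees\<close>

definition indep :: "('b \<Rightarrow> 'b \<Rightarrow> bool) \<Rightarrow> 'b set \<Rightarrow> bool" where
  "indep adj J \<longleftrightarrow> (\<forall>v\<in>J. \<forall>w\<in>J. v \<noteq> w \<longrightarrow> \<not> adj v w)"

text \<open>The independence polynomial of the graph induced on \<open>A\<close>, the hard-core
  partition function at fugacity \<open>y\<close>. Weighting sets by \<open>y\<close>, rather than
  counting those of one size, keeps the branching recursion to a single inequality.\<close>

definition indep_poly :: "('b \<Rightarrow> 'b \<Rightarrow> bool) \<Rightarrow> 'b set \<Rightarrow> real \<Rightarrow> real" where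
  "indep_poly adj A y = (\<Sum>J | J \<subseteq> A \<and> indep adj J. y ^ card J)"

lemma indep_poly_le_power:
  assumes "finite A" "0 \<le> y"
  shows "indep_poly adj A y \<le> (1 + y) ^ card A"
proof -
  have "indep_poly adj A y \<le> (\<Sum>J\<in>Pow A. y ^ card J)"
    unfolding indep_poly_def using assms by (intro sum_mono2) auto
  also have "\<dots> = (\<Prod>x\<in>A. y + 1)"
    using assms by (subst prod_add) auto
  finally show ?thesis by (simp add: add.commute)
qed

text \<open>The two terms collect the independent sets that avoid \<open>v\<close> and those that
  contain it; the latter also avoid the neighbours of \<open>v\<close>.\<close>

lemma indep_poly_remove:
  assumes "finite A" "v \<in> A" "0 \<le> y"
  shows "indep_poly adj A y \<le>
    indep_poly adj (A - {v}) y + y * indep_poly adj (A - {v} - {w \<in> A. w \<noteq> v \<and> adj v w}) y"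
proof -
  let ?X = "{J. J \<subseteq> A - {v} \<and> indep adj J}"
  let ?Y = "{J. J \<subseteq> A - {v} - {w \<in> A. w \<noteq> v \<and> adj v w} \<and> indep adj J}"
  have fin: "finite ?X" "finite ?Y" using assms(1) by auto
  have inj: "inj_on (insert v) ?Y" by (rule inj_onI) blast
  have "{J. J \<subseteq> A \<and> indep adj J} \<subseteq> ?X \<union> insert v ` ?Y"
  proof
    fix J assume J: "J \<in> {J. J \<subseteq> A \<and> indep adj J}"
    show "J \<in> ?X \<union> insert v ` ?Y"
    proof (cases "v \<in> J")
      case True
      hence "J = insert v (J - {v})" "J - {v} \<in> ?Y" using J by (auto simp: indep_def)
      thus ?thesis by blast
    qed (use J in auto)
  qed
  hence "indep_poly adj A y \<le> (\<Sum>J\<in>?X \<union> insert v ` ?Y. y ^ card J)"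
    unfolding indep_poly_def using assms fin by (intro sum_mono2) auto
  also have "\<dots> \<le> (\<Sum>J\<in>?X. y ^ card J) + (\<Sum>J\<in>insert v ` ?Y. y ^ card J)"
    using fin assms by (subst sum_Un) (auto intro!: sum_nonneg)
  also have "(\<Sum>J\<in>insert v ` ?Y. y ^ card J) = (\<Sum>J\<in>?Y. y ^ card (insert v J))"
    by (simp add: sum.reindex[OF inj])
  also have "\<dots> = (\<Sum>J\<in>?Y. y * y ^ card J)"
  proof (intro sum.cong refl)
    fix J assume "J \<in> ?Y"
    hence "finite J" "v \<notin> J" using assms(1) by (auto intro: finite_subset)
    thus "y ^ card (insert v J) = y * y ^ card J" by simp
  qed
  finally show ?thesis by (simp add: indep_poly_def sum_distrib_left)
qed

text \<open>The Kleitman--Winston argument: branching on a vertex of large degree, the branch that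
  contains the vertex shrinks the vertex set by a factor \<open>exp (-\<beta>)\<close>, which can happen only \<open>s\<close>
  times before at most \<open>R\<close> vertices are left.\<close>

lemma indep_poly_le_of_large_degrees:
  fixes \<beta> \<mu> y :: real
  assumes "finite A" "0 \<le> y" "y \<le> \<mu>" "1 \<le> \<mu>"
    and "\<And>A'. A' \<subseteq> A \<Longrightarrow> card A' > R \<Longrightarrow>
      \<exists>v\<in>A'. \<beta> * card A' \<le> card {w \<in> A'. w \<noteq> v \<and> adj v w}"
    and "card A * exp (- \<beta> * s) \<le> R"
  shows "indep_poly adj A y \<le> (1 + y) ^ R * (\<mu> * (card A + 1)) ^ s"
  using assms
proof (induction "card A" arbitrary: A s rule: less_induct)
  case less
  note y = less.prems(2-4)
  have one: "1 \<le> \<mu> * (card A + 1)"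
    using y mult_mono[of 1 \<mu> 1 "real (card A + 1)"] by auto
  show ?case
  proof (cases "card A \<le> R")
    \<comment> \<open>With at most \<open>R\<close> vertices left nothing is gained from branching,
      and all subsets are counted.\<close>
    case True
    have "indep_poly adj A y \<le> (1 + y) ^ card A * 1"
      using indep_poly_le_power less.prems by simp
    also have "\<dots> \<le> (1 + y) ^ R * (\<mu> * (card A + 1)) ^ s"
      using True y one by (intro mult_mono power_increasing one_le_power) auto
    finally show ?thesis .
  next
    case False
    then obtain v where v: "v \<in> A" "\<beta> * card A \<le> card {w \<in> A. w \<noteq> v \<and> adj v w}"
      using less.prems(5)[of A] by auto
    let ?N = "{w \<in> A. w \<noteq> v \<and> adj v w}"
    let ?A1 = "A - {v}" and ?A2 = "A - {v} - {w \<in> A. w \<noteq> v \<and> adj v w}"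
    define n where "n = card A"
    have n0: "n > 0" using v less.prems(1) by (auto simp: n_def card_gt_0_iff)
    \<comment> \<open>For \<open>s = 0\<close> the last assumption would already say
      \<open>card A \<le> R\<close>.\<close>
    obtain s' where s': "s = Suc s'"
      using False less.prems(6) by (cases s) auto
    have c1: "card ?A1 = n - 1" using v less.prems(1) by (simp add: n_def)
    have c2: "card ?A2 \<le> n - 1"
      using card_mono[of ?A1 ?A2] c1 less.prems(1) by auto
    have "card ?A2 \<le> card (A - ?N)" using less.prems(1) by (intro card_mono) auto
    also have "\<dots> = n - card ?N" using less.prems(1) by (subst card_Diff_subset) (auto simp: n_def)
    finally have "real (card ?A2) \<le> real n - real (card ?N)"
      using card_mono[of A ?N] less.prems(1) by (simp add: n_def)
    also have "\<dots> \<le> (1 + (- \<beta>)) * n" using v by (simp add: n_def algebra_simps)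
    also have "\<dots> \<le> exp (- \<beta>) * n"
      by (intro mult_right_mono exp_ge_add_one_self) auto
    finally have "card ?A2 * exp (- \<beta> * s') \<le> exp (- \<beta>) * n * exp (- \<beta> * s')"
      by (intro mult_right_mono) auto
    also have "\<dots> = n * exp (- \<beta> * s)"
      by (simp add: s' algebra_simps flip: exp_add)
    also have "\<dots> \<le> R" using less.prems(6) by (simp add: n_def)
    finally have A2: "card ?A2 * exp (- \<beta> * s') \<le> R" .
    have "card ?A1 * exp (- \<beta> * s) \<le> card A * exp (- \<beta> * s)"
      using less.prems(1) by (intro mult_right_mono) (auto intro!: card_mono)
    hence A1: "card ?A1 * exp (- \<beta> * s) \<le> R" using less.prems(6) by linarith
    \<comment> \<open>Avoiding \<open>v\<close> costs one vertex but no step; containing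
      \<open>v\<close>, treated next, spends one of the \<open>s\<close> steps.\<close>
    have "indep_poly adj ?A1 y \<le> (1 + y) ^ R * (\<mu> * (card ?A1 + 1)) ^ s"
      by (rule less.hyps[OF _ _ y _ A1])
         (use c1 n0 n_def less.prems(1) in auto, rule less.prems(5), auto)
    also have "real (card ?A1 + 1) = n" using c1 n0 by simp
    finally have I1: "indep_poly adj ?A1 y \<le> (1 + y) ^ R * (\<mu> * n) ^ s" .
    have "indep_poly adj ?A2 y \<le> (1 + y) ^ R * (\<mu> * (card ?A2 + 1)) ^ s'"
      by (rule less.hyps[OF _ _ y _ A2])
         (use c2 n0 n_def less.prems(1) in auto, rule less.prems(5), auto)
    also have "\<dots> \<le> (1 + y) ^ R * (\<mu> * n) ^ s'"
      using c2 n0 y by (intro mult_left_mono power_mono) auto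
    finally have I2: "indep_poly adj ?A2 y \<le> (1 + y) ^ R * (\<mu> * n) ^ s'" .
    have "indep_poly adj A y \<le> indep_poly adj ?A1 y + y * indep_poly adj ?A2 y"
      by (rule indep_poly_remove) (use less.prems v in auto)
    also have "\<dots> \<le> (1 + y) ^ R * (\<mu> * n) ^ s + \<mu> * ((1 + y) ^ R * (\<mu> * n) ^ s')"
      using I1 I2 y by (intro add_mono mult_mono) (auto simp: indep_poly_def intro!: sum_nonneg)
    \<comment> \<open>The summands \<open>n\<close> and 1 of the two branches add up to
      \<open>n + 1\<close>; this is why the claimed bound is built on
      \<open>card A + 1\<close>.\<close>
    also have "\<dots> = (1 + y) ^ R * ((\<mu> * (n + 1)) * (\<mu> * n) ^ s')"
      by (simp add: s' algebra_simps)
    also have "\<dots> \<le> (1 + y) ^ R * ((\<mu> * (n + 1)) * (\<mu> * (n + 1)) ^ s')"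
      using y by (intro mult_left_mono power_mono) auto
    finally show ?thesis by (simp add: s' n_def)
  qed
qed

section \<open>Caps in linear spaces\<close>

text \<open>A Steiner system with parameters \<open>S(2, q + 1, card V)\<close>. The counting of
  caps and the deletion argument use nothing else about projective space.\<close>

locale linear_space =
  fixes V :: "'b set" and B :: "'b set set" and q :: nat
  assumes finite_points: "finite V"
    and q_pos: "q > 0"
    and line_subset: "L \<in> B \<Longrightarrow> L \<subseteq> V"
    and card_line: "L \<in> B \<Longrightarrow> card L = q + 1"
    and line_through: "x \<in> V \<Longrightarrow> y \<in> V \<Longrightarrow> x \<noteq> y \<Longrightarrow> \<exists>!L. L \<in> B \<and> x \<in> L \<and> y \<in> L"
begin

definition cap :: "'b set \<Rightarrow> bool" where
  "cap I \<longleftrightarrow> I \<subseteq> V \<and> (\<forall>T. T \<subseteq> I \<and> card T = 3 \<longrightarrow> \<not> (\<exists>L\<in>B. T \<subseteq> L))"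

definition triples :: "'b set set" where
  "triples = {T. T \<subseteq> V \<and> card T = 3 \<and> (\<exists>L\<in>B. T \<subseteq> L)}"

definition cap_number :: "'b set \<Rightarrow> nat" where
  "cap_number S = Max (card ` {I. I \<subseteq> S \<and> cap I})"

abbreviation pencil :: "'b \<Rightarrow> 'b set set" where
  "pencil x \<equiv> {L \<in> B. x \<in> L}"

text \<open>The replication number of the design. The division is exact as soon as there is a point;
  in \<open>PG(r,q)\<close> the value is \<open>1 + q + ... + q^(r-1)\<close>.\<close>

definition pencil_size :: nat where
  "pencil_size = (card V - 1) div q"

lemma finite_lines: "finite B"
  using finite_points line_subset by (intro finite_subset[of B "Pow V"]) auto

lemma finite_line: "L \<in> B \<Longrightarrow> finite L"
  by (rule finite_subset[OF line_subset finite_points])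

lemma line_unique: "L \<in> B \<Longrightarrow> L' \<in> B \<Longrightarrow> x \<in> L \<Longrightarrow> y \<in> L \<Longrightarrow> x \<in> L' \<Longrightarrow> y \<in> L' \<Longrightarrow> x \<noteq> y \<Longrightarrow> L = L'"
  using line_through[of x y] line_subset[of L] by blast

text \<open>The lines through \<open>x\<close> partition the remaining points into classes of size
  \<open>q\<close>.\<close>

lemma card_pencil:
  assumes "x \<in> V"
  shows "card (pencil x) = pencil_size"
proof -
  have "card (\<Union>L\<in>pencil x. L - {x}) = (\<Sum>L\<in>pencil x. card (L - {x}))"
  proof (rule card_UN_disjoint)
    show "\<forall>L\<in>pencil x. \<forall>L'\<in>pencil x. L \<noteq> L' \<longrightarrow> (L - {x}) \<inter> (L' - {x}) = {}"
      using line_unique by blast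
  qed (use finite_lines finite_line in auto)
  also have "\<dots> = (\<Sum>L\<in>pencil x. q)"
    using card_line finite_line by (intro sum.cong) auto
  also have "(\<Union>L\<in>pencil x. L - {x}) = V - {x}"
  proof (intro equalityI subsetI)
    fix y assume "y \<in> V - {x}"
    then obtain L where "L \<in> B" "x \<in> L" "y \<in> L" using line_through[OF assms, of y] by auto
    thus "y \<in> (\<Union>L\<in>pencil x. L - {x})" using \<open>y \<in> V - {x}\<close> by auto
  qed (use line_subset in auto)
  finally have "card (pencil x) * q = card V - 1"
    using assms finite_points by simp
  thus ?thesis using q_pos by (metis nonzero_mult_div_cancel_right pencil_size_def neq0_conv)
qed

lemma cap_subset: "cap I \<Longrightarrow> J \<subseteq> I \<Longrightarrow> cap J"
  by (auto simp: cap_def)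

lemma cap_card_Int_le:
  assumes "cap I" "L \<in> B"
  shows "card (I \<inter> L) \<le> 2"
proof (rule ccontr)
  assume "\<not> card (I \<inter> L) \<le> 2"
  hence "3 \<le> card (I \<inter> L)" by simp
  then obtain T where "T \<subseteq> I \<inter> L" "card T = 3"
    by (rule obtain_subset_with_card_n)
  moreover from this have "T \<subseteq> I" "T \<subseteq> L" by auto
  ultimately show False using assms unfolding cap_def by blast
qed

lemma finite_cap: "cap I \<Longrightarrow> finite I"
  unfolding cap_def using finite_points finite_subset by blast

text \<open>The pencil of \<open>x\<close> partitions \<open>A\<close>, and Cauchy--Schwarz bounds
  the sum of the squared part sizes below by \<open>card A ^ 2 / pencil_size\<close>. The squares
  also count the \<open>card A\<close> pairs with \<open>v = w\<close>; the assumed size of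
  \<open>A\<close> makes these at most half of the bound, whence the factor 2.\<close>

lemma sum_collinear_pairs_ge:
  assumes "x \<in> V" "A \<subseteq> V - {x}" "2 * pencil_size \<le> card A"
  shows "real (card A) ^ 2 \<le>
    2 * pencil_size * (\<Sum>v\<in>A. real (card {w \<in> A. w \<noteq> v \<and> (\<exists>L\<in>B. {x,v,w} \<subseteq> L)}))"
proof -
  have fA: "finite A" using assms finite_points by (auto intro: finite_subset)
  let ?f = "\<lambda>v. real (card {w \<in> A. w \<noteq> v \<and> (\<exists>L\<in>B. {x,v,w} \<subseteq> L)})"
  let ?a = "\<lambda>L. real (card (A \<inter> L))"
  have A: "A = (\<Union>L\<in>pencil x. A \<inter> L)"
    using assms line_through[of x] by blast
  have disj: "\<forall>L\<in>pencil x. \<forall>L'\<in>pencil x. L \<noteq> L' \<longrightarrow> (A \<inter> L) \<inter> (A \<inter> L') = {}"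
    using assms(2) line_unique by blast
  have sum_A: "sum g A = (\<Sum>L\<in>pencil x. sum g (A \<inter> L))" for g :: "'b \<Rightarrow> real"
    by (subst A, rule sum.UNION_disjoint) (use finite_lines fA disj in auto)
  have "sum ?f A = (\<Sum>L\<in>pencil x. \<Sum>v\<in>A \<inter> L. ?a L - 1)"
    unfolding sum_A
  proof (intro sum.cong refl)
    fix L v assume L: "L \<in> pencil x" and v: "v \<in> A \<inter> L"
    have "{w \<in> A. w \<noteq> v \<and> (\<exists>L\<in>B. {x,v,w} \<subseteq> L)} = A \<inter> L - {v}"
      using L v assms(2) line_unique[of L _ x v] by auto
    moreover have "card (A \<inter> L - {v}) = card (A \<inter> L) - 1"
      using v fA by simp
    moreover have "card (A \<inter> L) > 0" using v fA by (auto simp: card_gt_0_iff)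
    ultimately show "?f v = ?a L - 1" by (simp add: of_nat_diff)
  qed
  also have "\<dots> = (\<Sum>L\<in>pencil x. ?a L ^ 2) - (\<Sum>L\<in>pencil x. ?a L)"
    by (simp add: sum_subtractf[symmetric] power2_eq_square algebra_simps)
  also have "(\<Sum>L\<in>pencil x. ?a L) = card A"
    using sum_A[of "\<lambda>_. 1"] by simp
  finally have S: "sum ?f A = (\<Sum>L\<in>pencil x. ?a L ^ 2) - card A" .
  have "real (card A) ^ 2 = (\<Sum>L\<in>pencil x. ?a L) ^ 2"
    using sum_A[of "\<lambda>_. 1"] by simp
  also have "\<dots> \<le> (\<Sum>L\<in>pencil x. ?a L ^ 2) * card (pencil x)"
    by (rule sum_squared_le_sum_of_squares) 
  also have "\<dots> = pencil_size * (sum ?f A + card A)"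
    using S card_pencil[OF assms(1)] by simp
  finally have "real (card A) ^ 2 \<le> pencil_size * (sum ?f A + card A)" .
  moreover have "real (2 * pencil_size) * card A \<le> card A * real (card A)"
    using assms(3) by (intro mult_right_mono) auto
  ultimately show ?thesis
    unfolding power2_eq_square of_nat_mult of_nat_numeral distrib_left mult.assoc by linarith
qed

text \<open>Every edge of the graph below arises from at most two points of \<open>T\<close>, because these all lie
  on the line spanned by the edge and \<open>T\<close> is a cap.\<close>

lemma ex_large_degree:
  assumes "cap T" "A \<subseteq> V - T" "2 * pencil_size < card A"
  shows "\<exists>v\<in>A. (card T / (4 * pencil_size)) * card A \<le>
    card {w \<in> A. w \<noteq> v \<and> (\<exists>x\<in>T. \<exists>L\<in>B. {x,v,w} \<subseteq> L)}"
proof (rule ccontr)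
  define a where "a = real (card A)"
  have fA: "finite A" using assms finite_points by (auto intro: finite_subset)
  have fT: "finite T" using assms finite_cap by auto
  have TV: "T \<subseteq> V" using assms by (auto simp: cap_def)
  have "A \<noteq> {}" using assms(3) by auto
  have a0: "a > 0" using assms(3) by (simp add: a_def)
  let ?d = "\<lambda>v. real (card {w \<in> A. w \<noteq> v \<and> (\<exists>x\<in>T. \<exists>L\<in>B. {x,v,w} \<subseteq> L)})"
  let ?P = "\<lambda>x v w. w \<noteq> v \<and> (\<exists>L\<in>B. {x,v,w} \<subseteq> L)"
  assume "\<not> ?thesis"
  hence "\<forall>v\<in>A. ?d v < (card T / (4 * pencil_size)) * a" by (auto simp: a_def not_le)
  hence small: "(\<Sum>v\<in>A. ?d v) < (\<Sum>v\<in>A. (card T / (4 * pencil_size)) * a)"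
    using \<open>A \<noteq> {}\<close> fA by (intro sum_strict_mono) auto
  have two: "(\<Sum>x\<in>T. of_bool (?P x v w) :: real) \<le> 2 * of_bool (w \<noteq> v \<and> (\<exists>x\<in>T. \<exists>L\<in>B. {x,v,w} \<subseteq> L))"
    if "v \<in> A" "w \<in> A" for v w
  proof (cases "w \<noteq> v \<and> (\<exists>x\<in>T. \<exists>L\<in>B. {x,v,w} \<subseteq> L)")
    case True
    then obtain L where L: "L \<in> B" "v \<in> L" "w \<in> L" by auto
    have "(\<Sum>x\<in>T. of_bool (?P x v w) :: real) = card {x \<in> T. ?P x v w}"
      using fT by (simp add: of_bool_def sum.If_cases Int_def)
    also have "card {x \<in> T. ?P x v w} \<le> card (T \<inter> L)"
    proof (rule card_mono)
      show "{x \<in> T. ?P x v w} \<subseteq> T \<inter> L"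
      proof
        fix x assume x: "x \<in> {x \<in> T. ?P x v w}"
        then obtain L' where "w \<noteq> v" "L' \<in> B" "{x, v, w} \<subseteq> L'" by auto
        thus "x \<in> T \<inter> L" using x L line_unique[of L' L v w] by auto
      qed
    qed (use fT in auto)
    also have "card (T \<inter> L) \<le> 2" by (rule cap_card_Int_le[OF assms(1) L(1)])
    finally show ?thesis using True by simp
  qed (auto intro!: sum_nonpos)
  \<comment> \<open>Double counting of \<open>x\<close> in \<open>T\<close> together with ordered
    pairs \<open>v\<close>, \<open>w\<close> collinear with it. The 4 in the degree bound is the 2
    of the Cauchy--Schwarz lemma times the 2 of \<open>two\<close>.\<close>
  have "card T * a ^ 2 = (\<Sum>x\<in>T. a ^ 2)" by simp
  also have "\<dots> \<le> (\<Sum>x\<in>T. 2 * pencil_size * (\<Sum>v\<in>A. real (card {w \<in> A. ?P x v w})))"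
    unfolding a_def using assms TV by (intro sum_mono sum_collinear_pairs_ge) auto
  also have "\<dots> = 2 * pencil_size * (\<Sum>v\<in>A. \<Sum>x\<in>T. real (card {w \<in> A. ?P x v w}))"
    unfolding sum_distrib_left[symmetric] by (subst sum.swap) simp
  also have "(\<Sum>v\<in>A. \<Sum>x\<in>T. real (card {w \<in> A. ?P x v w})) = (\<Sum>v\<in>A. \<Sum>w\<in>A. \<Sum>x\<in>T. of_bool (?P x v w))"
  proof (rule sum.cong[OF refl])
    fix v
    have "real (card {w \<in> A. ?P x v w}) = (\<Sum>w\<in>A. of_bool (?P x v w))" for x
      using fA by (simp add: of_bool_def sum.If_cases Int_def)
    thus "(\<Sum>x\<in>T. real (card {w \<in> A. ?P x v w})) = (\<Sum>w\<in>A. \<Sum>x\<in>T. of_bool (?P x v w))"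
      by (simp only:) (rule sum.swap)
  qed
  also have "real (2 * pencil_size) * \<dots> \<le> real (2 * pencil_size) *
      (\<Sum>v\<in>A. \<Sum>w\<in>A. 2 * of_bool (w \<noteq> v \<and> (\<exists>x\<in>T. \<exists>L\<in>B. {x,v,w} \<subseteq> L)))"
    by (intro mult_left_mono sum_mono two) auto
  also have "\<dots> = 4 * pencil_size * (\<Sum>v\<in>A. ?d v)"
    using fA by (simp add: of_bool_def sum.If_cases Int_def sum_distrib_left[symmetric])
  finally have ge: "card T * a ^ 2 \<le> 4 * pencil_size * (\<Sum>v\<in>A. ?d v)" .
  show False
  proof (cases "pencil_size = 0")
    \<comment> \<open>Here the quotient by \<open>pencil_size\<close> is 0 by the convention for
      division, and \<open>small\<close> would make a sum of cardinalities negative.\<close>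
    case True
    then have "card T * a ^ 2 \<le> 0" using ge by simp
    hence "card T = 0" using a0 by (simp add: mult_le_0_iff)
    moreover have "0 \<le> (\<Sum>v\<in>A. ?d v)" by (rule sum_nonneg) simp
    ultimately show False using small by simp
  next
    case False
    hence "4 * pencil_size * (\<Sum>v\<in>A. ?d v) < 4 * pencil_size * (\<Sum>v\<in>A. (card T / (4 * pencil_size)) * a)"
      using small by (intro mult_strict_left_mono) auto
    also have "\<dots> = card T * a ^ 2"
      using False by (simp add: a_def power2_eq_square)
    finally show False using ge by simp
  qed
qed

text \<open>Some \<open>t\<close>-subset \<open>T\<close> is picked from each cap, which is then
  encoded as \<open>T\<close> and the remainder. There are at most \<open>card V ^ t\<close> choices
  for \<open>T\<close>, and the remainder is independent in the graph of \<open>T\<close>, so the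
  Kleitman--Winston bound applies with the degree ratio \<open>t / (4 * pencil_size)\<close>. The
  assumption on \<open>s\<close> says that \<open>s\<close> steps suffice to get down to
  \<open>2 * pencil_size\<close> points.\<close>

lemma sum_caps_le:
  fixes y \<mu> :: real
  assumes "t \<le> m" "0 \<le> y" "y \<le> \<mu>" "1 \<le> \<mu>"
    and "card V * exp (- (real t * s / (4 * pencil_size))) \<le> 2 * pencil_size"
  shows "(\<Sum>I | cap I \<and> card I = m. y ^ m) \<le>
    (card V * y) ^ t * ((1 + y) ^ (2 * pencil_size) * (\<mu> * (card V + 1)) ^ s)"
proof -
  let ?adj = "\<lambda>T v w. \<exists>x\<in>T. \<exists>L\<in>B. {x,v,w} \<subseteq> L"
  let ?C = "{I. cap I \<and> card I = m}" and ?F = "{T. cap T \<and> card T = t}"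
  let ?D = "\<lambda>T. {J. J \<subseteq> V - T \<and> indep (?adj T) J}"
  have fin: "finite ?C" "finite ?F" "\<And>T. finite (?D T)"
    using finite_points by (auto simp: cap_def intro: finite_subset[of _ "Pow V"])
  have "\<exists>T. T \<subseteq> I \<and> card T = t" if "I \<in> ?C" for I
    using obtain_subset_with_card_n[of t I] that assms(1) by auto
  then obtain f where f: "\<And>I. I \<in> ?C \<Longrightarrow> f I \<subseteq> I \<and> card (f I) = t" by metis
  have card_Diff: "card (I - f I) = m - t" if "I \<in> ?C" for I
    using that f[OF that] finite_cap[of I] by (auto simp: card_Diff_subset finite_subset)
  let ?g = "\<lambda>I. (f I, I - f I)"
  have inj: "inj_on ?g ?C"
  proof (rule inj_onI)
    fix I J assume "I \<in> ?C" "J \<in> ?C" "?g I = ?g J"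
    thus "I = J" using f[of I] f[of J] by (metis Diff_partition prod.inject)
  qed
  have img: "?g ` ?C \<subseteq> (SIGMA T:?F. ?D T)"
  proof safe
    fix I assume I: "cap I" "m = card I"
    note fI = f[of I] 
    show "cap (f I)" using I fI cap_subset by auto
    show "card (f I) = t" using I fI by auto
    fix v assume "v \<in> I" thus "v \<in> V" using I by (auto simp: cap_def)
  next
    fix I assume I: "cap I" "m = card I"
    have fI: "f I \<subseteq> I" using f[of I] I by auto
    show "indep (?adj (f I)) (I - f I)"
      unfolding indep_def
    proof (intro ballI impI notI)
      fix v w assume vw: "v \<in> I - f I" "w \<in> I - f I" "v \<noteq> w" "?adj (f I) v w"
      then obtain x L where x: "x \<in> f I" "L \<in> B" "{x,v,w} \<subseteq> L" by auto
      \<comment> \<open>The point \<open>x\<close> lies in \<open>f I\<close>, while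
        \<open>v\<close> and \<open>w\<close> lie outside it, so all three are distinct.\<close>
      hence "card {x,v,w} = 3" "{x,v,w} \<subseteq> I" using vw fI by (auto simp: card_insert_if)
      thus False using I x by (auto simp: cap_def simp del: insert_subset)
    qed
  qed
  have "(\<Sum>I\<in>?C. y ^ m) = (\<Sum>I\<in>?C. (\<lambda>(T,J). y ^ t * y ^ card J) (?g I))"
    using card_Diff assms(1) by (intro sum.cong refl) (simp flip: power_add)
  also have "\<dots> = (\<Sum>z\<in>?g ` ?C. (\<lambda>(T,J). y ^ t * y ^ card J) z)"
    by (simp add: sum.reindex[OF inj])
  \<comment> \<open>Admitting independent remainders of every size turns the inner sum into an
    independence polynomial.\<close>
  also have "\<dots> \<le> (\<Sum>z\<in>(SIGMA T:?F. ?D T). (\<lambda>(T,J). y ^ t * y ^ card J) z)"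
    using fin img assms by (intro sum_mono2) auto
  also have "\<dots> = (\<Sum>T\<in>?F. y ^ t * indep_poly (?adj T) (V - T) y)"
    using fin by (simp add: sum.Sigma[symmetric] indep_poly_def sum_distrib_left)
  also have "\<dots> \<le> (\<Sum>T\<in>?F. y ^ t * ((1 + y) ^ (2 * pencil_size) * (\<mu> * (card V + 1)) ^ s))"
  proof (intro sum_mono mult_left_mono)
    fix T assume T: "T \<in> ?F"
    have cVT: "card (V - T) \<le> card V" using finite_points by (intro card_mono) auto
    have "indep_poly (?adj T) (V - T) y \<le> (1 + y) ^ (2 * pencil_size) * (\<mu> * (card (V - T) + 1)) ^ s"
    proof (rule indep_poly_le_of_large_degrees[where \<beta> = "t / (4 * pencil_size)"])
      fix A' assume "A' \<subseteq> V - T" "card A' > 2 * pencil_size"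
      thus "\<exists>v\<in>A'. t / (4 * pencil_size) * card A' \<le> card {w \<in> A'. w \<noteq> v \<and> ?adj T v w}"
        using ex_large_degree[of T A'] T by auto
    next
      have "card (V - T) * exp (- (real t / (4 * pencil_size)) * s) \<le> card V * exp (- (real t / (4 * pencil_size)) * s)"
        using cVT by (intro mult_right_mono) auto
      thus "card (V - T) * exp (- (real t / (4 * pencil_size)) * s) \<le> real (2 * pencil_size)"
        using order_trans[OF _ assms(5)] by (simp add: mult_ac)
    qed (use finite_points assms in auto)
    also have "\<dots> \<le> (1 + y) ^ (2 * pencil_size) * (\<mu> * (card V + 1)) ^ s"
      using cVT assms by (intro mult_left_mono power_mono) auto
    finally show "indep_poly (?adj T) (V - T) y \<le> (1 + y) ^ (2 * pencil_size) * (\<mu> * (card V + 1)) ^ s" .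
  qed (use assms in auto)
  also have "\<dots> = real (card ?F) * y ^ t * ((1 + y) ^ (2 * pencil_size) * (\<mu> * (card V + 1)) ^ s)"
    by simp
  also have "\<dots> \<le> real (card V) ^ t * y ^ t * ((1 + y) ^ (2 * pencil_size) * (\<mu> * (card V + 1)) ^ s)"
  proof (intro mult_right_mono)
    have "card ?F \<le> card {T. T \<subseteq> V \<and> card T = t}"
      using finite_points by (intro card_mono) (auto simp: cap_def)
    also have "\<dots> = card V choose t" using finite_points by (rule n_subsets)
    also have "\<dots> \<le> card V ^ t"
      by (cases "t \<le> card V") (auto simp: binomial_le_pow binomial_eq_0)
    finally show "real (card ?F) \<le> real (card V) ^ t" by (metis of_nat_le_iff of_nat_power)
  qed (use assms in auto)
  finally show ?thesis by (simp add: power_mult_distrib)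
qed

text \<open>A union bound with an exponential tilt: \<open>p^m = exp (-m) * (exp 1 * p)^m\<close>.
  Counting caps at the larger weight costs only constants in the exponent and leaves the gain
  \<open>exp (-m)\<close>, which has to beat every other factor.\<close>

lemma prob_ex_cap_le:
  fixes p :: real
  assumes "t \<le> m" "0 \<le> p" "p \<le> 1"
    and "card V * exp (- (real t * s / (4 * pencil_size))) \<le> 2 * pencil_size"
  shows "measure_pmf.prob (random_subset V p) {S. \<exists>I. cap I \<and> card I = m \<and> I \<subseteq> S}
    \<le> exp (6 * p * pencil_size - m) * (3 * (card V + 1)) ^ (t + s)"
proof -
  \<comment> \<open>From \<open>exp 1 \<le> 3\<close> come \<open>y \<le> 3 * p\<close>, hence the 6
    in the exponent, and \<open>y \<le> 3\<close>, hence the choice 3 for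
    \<open>\<mu>\<close>.\<close>
  define y where "y = exp 1 * p"
  have e: "exp 1 \<le> (3::real)" by (rule exp_le)
  have y: "0 \<le> y" "y \<le> 3 * p" "y \<le> 3"
    using assms e mult_right_mono[of "exp 1" 3 p] mult_mono[of "exp 1" 3 p 1] by (auto simp: y_def)
  have "measure_pmf.prob (random_subset V p) {S. \<exists>I. cap I \<and> card I = m \<and> I \<subseteq> S} =
     measure_pmf.prob (random_subset V p) {S. \<exists>I\<in>{I. cap I \<and> card I = m}. I \<subseteq> S}"
    by (intro arg_cong[where f = "measure_pmf.prob _"]) auto
  also have "\<dots> \<le> (\<Sum>I | cap I \<and> card I = m. p ^ card I)"
    using finite_points assms by (intro prob_random_subset_ex_le) (auto simp: cap_def)
  also have "\<dots> = exp (- real m) * (\<Sum>I | cap I \<and> card I = m. y ^ m)"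
  proof -
    have "exp (- real m) * y ^ m = p ^ m"
      by (simp add: y_def power_mult_distrib exp_of_nat_mult[symmetric] exp_minus)
    hence "exp (- real m) * (\<Sum>I | cap I \<and> card I = m. y ^ m) = (\<Sum>I | cap I \<and> card I = m. p ^ m)"
      by (simp only: sum_distrib_left)
    moreover have "(\<Sum>I | cap I \<and> card I = m. p ^ card I) = (\<Sum>I | cap I \<and> card I = m. p ^ m)"
      by (intro sum.cong) auto
    ultimately show ?thesis by presburger
  qed
  also have "\<dots> \<le> exp (- real m) * ((card V * y) ^ t * ((1 + y) ^ (2 * pencil_size) * (3 * (card V + 1)) ^ s))"
    using sum_caps_le[OF assms(1) y(1) y(3) _ assms(4)] by (intro mult_left_mono) auto
  also have "\<dots> \<le> exp (- real m) * ((3 * (card V + 1)) ^ t * (exp (6 * p * pencil_size) * (3 * (card V + 1)) ^ s))"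
  proof -
    have "(1 + y) ^ (2 * pencil_size) \<le> exp y ^ (2 * pencil_size)"
      using y by (intro power_mono exp_ge_add_one_self) auto
    also have "\<dots> = exp (2 * pencil_size * y)" by (simp flip: exp_of_nat_mult)
    also have "\<dots> \<le> exp (6 * p * pencil_size)"
      using mult_left_mono[OF y(2), of "2 * pencil_size"] by (simp add: algebra_simps)
    finally have "(1 + y) ^ (2 * pencil_size) \<le> exp (6 * p * pencil_size)" .
    moreover have "card V * y \<le> 3 * (card V + 1)"
      using mult_left_mono[OF y(3), of "card V"] by simp
    hence "(card V * y) ^ t \<le> real (3 * (card V + 1)) ^ t"
      using y by (intro power_mono) auto
    ultimately show ?thesis using y
      unfolding of_nat_power by (intro mult_left_mono mult_mono mult_right_mono) auto
  qed
  also have "\<dots> = exp (6 * p * pencil_size - m) * (3 * (card V + 1)) ^ (t + s)"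
    by (simp add: exp_diff exp_minus power_add field_simps)
  finally show ?thesis .
qed

section \<open>Largest caps inside a set of points, and the number of collinear triples\<close>

lemma finite_caps_in: "finite {I. I \<subseteq> S \<and> cap I}"
  using finite_points by (auto simp: cap_def intro: finite_subset[of _ "Pow V"])

lemma card_le_cap_number: "cap I \<Longrightarrow> I \<subseteq> S \<Longrightarrow> card I \<le> cap_number S"
  unfolding cap_number_def using finite_caps_in by (intro Max_ge) auto

lemma ex_cap_of_card:
  assumes "m \<le> cap_number S"
  obtains I where "cap I" "I \<subseteq> S" "card I = m"
proof -
  \<comment> \<open>The empty cap ensures that the maximum is taken over a nonempty set.\<close>
  have "{} \<in> {I. I \<subseteq> S \<and> cap I}" by (auto simp: cap_def)
  hence "card ` {I. I \<subseteq> S \<and> cap I} \<noteq> {}" by blast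
  hence "cap_number S \<in> card ` {I. I \<subseteq> S \<and> cap I}"
    unfolding cap_number_def using finite_caps_in by (intro Max_in) auto
  then obtain J where J: "cap J" "J \<subseteq> S" "card J = cap_number S" by auto
  then obtain I where "I \<subseteq> J" "card I = m"
    using obtain_subset_with_card_n[of m J] assms by auto
  thus ?thesis using that J cap_subset by blast
qed

lemma cap_number_mono: "S \<subseteq> S' \<Longrightarrow> cap_number S \<le> cap_number S'"
  using ex_cap_of_card[of "cap_number S" S] card_le_cap_number by (metis order_refl subset_trans)

lemma cap_number_le_card: "finite S \<Longrightarrow> cap_number S \<le> card S"
  using ex_cap_of_card[of "cap_number S" S] card_mono by (metis order_refl)

text \<open>Deleting one point from every collinear triple leaves a cap.\<close>

lemma cap_number_ge_deletion:
  assumes "S \<subseteq> V"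
  shows "card S \<le> cap_number S + card {T \<in> triples. T \<subseteq> S}"
proof -
  let ?X = "{T \<in> triples. T \<subseteq> S}"
  have fS: "finite S" using assms finite_points by (rule finite_subset)
  have fX: "finite ?X" using fS by (auto intro: finite_subset[of _ "Pow S"])
  have ne: "T \<noteq> {}" if "T \<in> triples" for T using that by (auto simp: triples_def)
  define h where "h T = (SOME x. x \<in> T)" for T :: "'b set"
  have h: "h T \<in> T" if "T \<in> triples" for T using ne[OF that] by (simp add: h_def some_in_eq)
  have "cap (S - h ` ?X)"
    unfolding cap_def
  proof safe
    fix T L assume T: "T \<subseteq> S - h ` ?X" "card T = 3" "L \<in> B" "T \<subseteq> L"
    hence "T \<in> ?X" using assms by (auto simp: triples_def)
    thus False using h[of T] T by auto
  qed (use assms in auto)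
  hence "card (S - h ` ?X) \<le> cap_number S" by (rule card_le_cap_number) auto
  moreover have "card S - card (h ` ?X) \<le> card (S - h ` ?X)" by (rule diff_card_le_card_Diff) (use fX in auto)
  moreover have "card (h ` ?X) \<le> card ?X" by (rule card_image_le[OF fX])
  ultimately show ?thesis by linarith
qed

text \<open>Two distinct points of a triple determine its line, which leaves at most
  \<open>q + 1\<close> choices for the third. Counting ordered pairs loses only a constant.\<close>

lemma card_triples_le: "card triples \<le> card V ^ 2 * (q + 1)"
proof -
  define l where "l x y = (THE L. L \<in> B \<and> x \<in> L \<and> y \<in> L)" for x y
  let ?P = "{(x,y). x \<in> V \<and> y \<in> V \<and> x \<noteq> y}"
  have l: "l x y = L" if "L \<in> B" "x \<in> L" "y \<in> L" "x \<noteq> y" for x y L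
    unfolding l_def using that line_unique by (intro the_equality) auto
  have fP: "finite ?P" using finite_points by (auto intro: finite_subset[of _ "V \<times> V"])
  have lB: "l x y \<in> B" if "x \<in> V" "y \<in> V" "x \<noteq> y" for x y
    using line_through[OF that] l[of _ x y] that by auto
  let ?D = "SIGMA z:?P. l (fst z) (snd z)"
  have fD: "finite ?D" using fP lB finite_line by (intro finite_SigmaI) auto
  have "triples \<subseteq> (\<lambda>((x,y),z). {x,y,z}) ` ?D"
  proof
    fix T assume "T \<in> triples"
    then obtain L x y z where T: "T = {x,y,z}" "x \<noteq> y" "L \<in> B" "T \<subseteq> L" "T \<subseteq> V"
      by (auto simp: triples_def card_3_iff)
    hence "((x,y),z) \<in> ?D" using l[of L x y] by auto
    thus "T \<in> (\<lambda>((x,y),z). {x,y,z}) ` ?D" using T(1) by (auto intro!: rev_image_eqI)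
  qed
  hence "card triples \<le> card ((\<lambda>((x,y),z). {x,y,z}) ` ?D)" using fD by (intro card_mono) auto
  also have "\<dots> \<le> card ?D" by (rule card_image_le[OF fD])
  also have "\<dots> = (\<Sum>z\<in>?P. card (l (fst z) (snd z)))"
    using fP lB finite_line by (subst card_SigmaI) auto
  also have "\<dots> = (\<Sum>z\<in>?P. q + 1)"
    using lB card_line by (intro sum.cong) auto
  also have "\<dots> = card ?P * (q + 1)" by simp
  also have "\<dots> \<le> card (V \<times> V) * (q + 1)"
    using finite_points by (intro mult_right_mono card_mono) auto
  finally show ?thesis by (simp add: card_cartesian_product power2_eq_square)
qed

end

section \<open>Finite projective spaces\<close>

text \<open>Coordinates with respect to a finite basis. This converts every statement about
  dimension into one about cardinality.\<close>

lemma (in vectorspace) card_carrier: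
  assumes "finite (carrier V)"
  shows "card (carrier V) = card (carrier K) ^ dim"
proof -
  have "gen_set (carrier V)"
    using span_is_subset2[of "carrier V"] in_own_span[of "carrier V"] by auto
  hence fd: "fin_dim" using assms by (auto simp: fin_dim_def)
  then obtain \<beta> where \<beta>: "finite \<beta>" "basis \<beta>" using finite_basis_exists by auto
  have \<beta>V: "\<beta> \<subseteq> carrier V" using \<beta> by (auto simp: basis_def)
  have uni: "\<exists>!a. a \<in> \<beta> \<rightarrow>\<^sub>E carrier K \<and> lincomb a \<beta> = v" if "v \<in> carrier V" for v
    using basis_criterion[OF \<beta>(1) \<beta>V] \<beta>(2) that by blast
  have cl: "lincomb a \<beta> \<in> carrier V" if "a \<in> \<beta> \<rightarrow>\<^sub>E carrier K" for a
    using that \<beta>V by (intro lincomb_closed) auto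
  have "bij_betw (\<lambda>a. lincomb a \<beta>) (\<beta> \<rightarrow>\<^sub>E carrier K) (carrier V)"
    unfolding bij_betw_def
  proof
    show "inj_on (\<lambda>a. lincomb a \<beta>) (\<beta> \<rightarrow>\<^sub>E carrier K)"
      using uni cl by (intro inj_onI) metis
    show "(\<lambda>a. lincomb a \<beta>) ` (\<beta> \<rightarrow>\<^sub>E carrier K) = carrier V"
      using uni cl by blast
  qed
  hence "card (carrier V) = card (\<beta> \<rightarrow>\<^sub>E carrier K)" by (simp add: bij_betw_same_card)
  also have "\<dots> = card (carrier K) ^ card \<beta>" using \<beta> by (simp add: card_PiE)
  also have "card \<beta> = dim" using dim_basis[OF \<beta>] by simp
  finally show ?thesis .
qed

text \<open>The map sending \<open>t\<close> to \<open>t^2 - t\<close> takes the same value at 0 and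
  1, so on a finite field it is not injective and hence not surjective. This works uniformly in all
  characteristics.\<close>

lemma (in field) ex_not_of_form_square_minus_self:
  assumes "finite (carrier R)"
  shows "\<exists>c\<in>carrier R. \<forall>t\<in>carrier R. t \<otimes> t \<ominus> t \<ominus> c \<noteq> \<zero>"
proof -
  let ?g = "\<lambda>t. t \<otimes> t \<ominus> t"
  have "?g \<zero> = ?g \<one>" by (simp add: a_minus_def r_neg)
  hence "\<not> inj_on ?g (carrier R)" using zero_not_one inj_onD[of ?g "carrier R" \<zero> \<one>] by auto
  moreover have "?g ` carrier R \<subseteq> carrier R" by auto
  ultimately obtain c where "c \<in> carrier R" "c \<notin> ?g ` carrier R"
    using endo_inj_surj finite_surj_inj[OF assms, of ?g] by blast
  thus ?thesis by (intro bexI[of _ c]) (auto simp: r_right_minus_eq)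
qed

text \<open>The homogenisation of \<open>t^2 - t - c\<close>; for irreducible
  \<open>t^2 - t - c\<close> it is the norm form of the quadratic extension. A form
  \<open>x^2 - c y^2\<close> would fail in characteristic 2, where every element of a finite field
  is a square.\<close>

definition (in ring) qform :: "'a \<Rightarrow> 'a \<Rightarrow> 'a \<Rightarrow> 'a" where
  "qform c x y = x \<otimes> x \<ominus> x \<otimes> y \<ominus> c \<otimes> (y \<otimes> y)"

lemma (in cring) qform_closed [simp]:
  "c \<in> carrier R \<Longrightarrow> x \<in> carrier R \<Longrightarrow> y \<in> carrier R \<Longrightarrow> qform c x y \<in> carrier R"
  by (simp add: qform_def)

text \<open>Along a line with direction \<open>(d, e)\<close> the form is a quadratic polynomial in
  the parameter \<open>b\<close> with leading coefficient \<open>qform c d e\<close>;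
  \<open>B\<close> is the value of the polar form.\<close>

lemma (in cring) qform_add_smult:
  assumes [simp]: "c \<in> carrier R" "b \<in> carrier R"
    "x \<in> carrier R" "y \<in> carrier R" "d \<in> carrier R" "e \<in> carrier R"
  defines "B \<equiv> x \<otimes> d \<oplus> d \<otimes> x \<ominus> (x \<otimes> e \<oplus> d \<otimes> y) \<ominus> c \<otimes> (y \<otimes> e \<oplus> e \<otimes> y)"
  shows "qform c (x \<oplus> b \<otimes> d) (y \<oplus> b \<otimes> e) = qform c x y \<oplus> b \<otimes> B \<oplus> b \<otimes> b \<otimes> qform c d e"
  unfolding qform_def B_def
  by (simp add: a_minus_def l_distr r_distr minus_add l_minus r_minus a_ac m_ac)

text \<open>If \<open>y\<close> were nonzero, dividing by \<open>y^2\<close> would make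
  \<open>x / y\<close> a root of \<open>t^2 - t - c\<close>.\<close>

lemma (in field) qform_anisotropic:
  assumes c: "c \<in> carrier R" "\<forall>t\<in>carrier R. t \<otimes> t \<ominus> t \<ominus> c \<noteq> \<zero>"
    and [simp]: "x \<in> carrier R" "y \<in> carrier R" and 0: "qform c x y = \<zero>"
  shows "x = \<zero> \<and> y = \<zero>"
proof (cases "y = \<zero>")
  case True
  thus ?thesis using 0 c(1) by (auto simp: qform_def integral_iff a_minus_def)
next
  case False
  define i where "i = inv y"
  have i [simp]: "i \<in> carrier R" "y \<otimes> i = \<one>" using False by (auto simp: i_def field_Units)
  note [simp] = c(1)
  have "(x \<otimes> i) \<otimes> (x \<otimes> i) \<ominus> (x \<otimes> i) \<otimes> (y \<otimes> i) \<ominus> c \<otimes> ((y \<otimes> i) \<otimes> (y \<otimes> i)) = qform c x y \<otimes> (i \<otimes> i)"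
    unfolding qform_def by (simp add: a_minus_def l_distr r_distr minus_add l_minus r_minus a_ac m_ac)
  hence "(x \<otimes> i) \<otimes> (x \<otimes> i) \<ominus> (x \<otimes> i) \<ominus> c = \<zero>" by (simp add: 0)
  thus ?thesis using c(2) by auto
qed

section \<open>Points and lines as sets of vectors, and their numbers\<close>

locale finite_projective_space = field K for K :: "'a ring" (structure) +
  fixes r q :: nat
  assumes order: "order K = q" and q_ge_2: "q \<ge> 2"
begin

abbreviation W0 where "W0 \<equiv> coord_space K r"

lemma finite_field: "finite (carrier K)" and card_field: "card (carrier K) = q"
  using order q_ge_2 by (auto simp: order_def intro: card_ge_0_finite)

sublocale vs: vectorspace K W0
  using func_space_is_module field_axioms by (intro vectorspace.intro) auto

lemma carrier_W0: "carrier W0 = {..r} \<rightarrow>\<^sub>E carrier K"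
  by (simp add: func_space_def)

lemma finite_W0: "finite (carrier W0)" and card_W0: "card (carrier W0) = q ^ (r + 1)"
  using finite_field card_field by (auto simp: carrier_W0 card_PiE intro!: finite_PiE)

lemma subspaceD:
  assumes "subspace K W W0"
  shows "W \<subseteq> carrier W0" "\<zero>\<^bsub>W0\<^esub> \<in> W" "\<And>x y. x \<in> W \<Longrightarrow> y \<in> W \<Longrightarrow> x \<oplus>\<^bsub>W0\<^esub> y \<in> W"
    "\<And>c x. c \<in> carrier K \<Longrightarrow> x \<in> W \<Longrightarrow> c \<odot>\<^bsub>W0\<^esub> x \<in> W" "finite W"
proof -
  from assms have s: "submodule K W W0" by (simp add: subspace_def)
  show "W \<subseteq> carrier W0" "\<zero>\<^bsub>W0\<^esub> \<in> W" using s by (auto simp: submodule_def)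
  show "\<And>x y. x \<in> W \<Longrightarrow> y \<in> W \<Longrightarrow> x \<oplus>\<^bsub>W0\<^esub> y \<in> W"
    "\<And>c x. c \<in> carrier K \<Longrightarrow> x \<in> W \<Longrightarrow> c \<odot>\<^bsub>W0\<^esub> x \<in> W" using s by (auto simp: submodule_def)
  show "finite W" using \<open>W \<subseteq> carrier W0\<close> finite_W0 by (rule finite_subset)
qed

text \<open>From here on points and lines are recognised by having \<open>q\<close> and
  \<open>q^2\<close> vectors, and inclusions become equalities by counting.\<close>

lemma pg_subspaces_iff: "W \<in> pg_subspaces K r d \<longleftrightarrow> subspace K W W0 \<and> card W = q ^ (d + 1)"
proof (cases "subspace K W W0")
  case True
  interpret sub: vectorspace K "W0\<lparr>carrier := W\<rparr>" by (rule vs.subspace_is_vs[OF True])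
  have "card W = q ^ sub.dim"
    using sub.card_carrier subspaceD(5)[OF True] card_field by simp
  moreover have "q ^ sub.dim = q ^ (d + 1) \<longleftrightarrow> sub.dim = d + 1"
    using q_ge_2 by (intro power_inject_exp) auto
  ultimately show ?thesis using True by (simp add: pg_subspaces_def)
qed (simp add: pg_subspaces_def)

lemma pg_subspace_subset: "W \<in> pg_subspaces K r d \<Longrightarrow> W \<subseteq> carrier W0"
  using subspaceD(1) pg_subspaces_iff by blast

definition pt :: "(nat \<Rightarrow> 'a) \<Rightarrow> (nat \<Rightarrow> 'a) set" where
  "pt v = (\<lambda>c. c \<odot>\<^bsub>W0\<^esub> v) ` carrier K"

lemma mem_pt: "v \<in> carrier W0 \<Longrightarrow> v \<in> pt v"
  unfolding pt_def by (rule image_eqI[of _ _ \<one>]) auto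

lemma smult_eq_0_iff:
  assumes "c \<in> carrier K" "v \<in> carrier W0" "c \<odot>\<^bsub>W0\<^esub> v = \<zero>\<^bsub>W0\<^esub>" "c \<noteq> \<zero>"
  shows "v = \<zero>\<^bsub>W0\<^esub>"
  using vs.mult_inverse[of c v "\<zero>\<^bsub>W0\<^esub>"] assms by (simp add: field_Units)

lemma pt_is_point:
  assumes v: "v \<in> carrier W0" "v \<noteq> \<zero>\<^bsub>W0\<^esub>"
  shows "pt v \<in> pg_points K r"
proof -
  have "submodule K (pt v) W0"
  proof (rule submodule.intro)
    show "module K W0" by (rule vs.module_axioms)
    show "pt v \<subseteq> carrier W0" using v by (auto simp: pt_def)
    show "\<zero>\<^bsub>W0\<^esub> \<in> pt v" unfolding pt_def using v by (intro image_eqI[of _ _ \<zero>]) auto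
  next
    fix x y assume "x \<in> pt v" "y \<in> pt v"
    then obtain a b where "a \<in> carrier K" "b \<in> carrier K" "x = a \<odot>\<^bsub>W0\<^esub> v" "y = b \<odot>\<^bsub>W0\<^esub> v"
      by (auto simp: pt_def)
    thus "x \<oplus>\<^bsub>W0\<^esub> y \<in> pt v" unfolding pt_def using v
      by (intro image_eqI[of _ _ "a \<oplus> b"]) (auto simp: vs.smult_l_distr)
  next
    fix c x assume "c \<in> carrier K" "x \<in> pt v"
    then obtain a where "a \<in> carrier K" "c \<in> carrier K" "x = a \<odot>\<^bsub>W0\<^esub> v"
      by (auto simp: pt_def)
    thus "c \<odot>\<^bsub>W0\<^esub> x \<in> pt v" unfolding pt_def using v
      by (intro image_eqI[of _ _ "c \<otimes> a"]) (auto simp: vs.smult_assoc1)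
  qed
  hence sub: "subspace K (pt v) W0" using vs.vectorspace_axioms by (simp add: subspace_def)
  have "inj_on (\<lambda>c. c \<odot>\<^bsub>W0\<^esub> v) (carrier K)"
  proof (rule inj_onI)
    fix a b assume ab: "a \<in> carrier K" "b \<in> carrier K" "a \<odot>\<^bsub>W0\<^esub> v = b \<odot>\<^bsub>W0\<^esub> v"
    have "(a \<ominus> b) \<odot>\<^bsub>W0\<^esub> v = \<zero>\<^bsub>W0\<^esub>"
      using ab v by (simp add: a_minus_def vs.smult_l_distr vs.smult_l_minus vs.M.r_neg)
    hence "a \<ominus> b = \<zero>" using smult_eq_0_iff[of "a \<ominus> b" v] ab v by auto
    thus "a = b" using ab by simp
  qed
  hence "card (pt v) = q" by (simp add: pt_def card_image card_field)
  thus ?thesis using sub by (simp add: pg_subspaces_iff)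
qed

lemma pt_subset: "subspace K W W0 \<Longrightarrow> v \<in> W \<Longrightarrow> pt v \<subseteq> W"
  using subspaceD(4) by (auto simp: pt_def)

lemma point_eq_pt:
  assumes "P \<in> pg_points K r" "v \<in> P" "v \<noteq> \<zero>\<^bsub>W0\<^esub>"
  shows "P = pt v"
proof -
  have P: "subspace K P W0" "card P = q" using assms(1) by (auto simp: pg_subspaces_iff)
  have "v \<in> carrier W0" using subspaceD[OF P(1)] assms by auto
  hence "card (pt v) = q" using pt_is_point assms(3) by (auto simp: pg_subspaces_iff)
  thus ?thesis using card_subset_eq[of P "pt v"] pt_subset[OF P(1) assms(2)] P subspaceD[OF P(1)] by auto
qed

lemma points_disjoint:
  assumes "P \<in> pg_points K r" "Q \<in> pg_points K r" "P \<noteq> Q"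
  shows "P \<inter> Q = {\<zero>\<^bsub>W0\<^esub>}"
proof -
  have "\<zero>\<^bsub>W0\<^esub> \<in> P \<inter> Q" using assms subspaceD(2) by (auto simp: pg_subspaces_iff)
  thus ?thesis using assms point_eq_pt by blast
qed

text \<open>The nonzero vectors of \<open>W\<close> are partitioned by the points inside
  \<open>W\<close>, each of which has \<open>q - 1\<close> of them.\<close>

lemma card_points_in_subspace:
  assumes "subspace K W W0"
  shows "card {P \<in> pg_points K r. P \<subseteq> W} * (q - 1) = card W - 1"
proof -
  let ?X = "{P \<in> pg_points K r. P \<subseteq> W}"
  let ?z = "\<zero>\<^bsub>W0\<^esub>"
  note W = subspaceD[OF assms]
  have fX: "finite ?X" using W(5) by (auto intro: finite_subset[of _ "Pow W"])
  have P: "finite P" "card P = q" "?z \<in> P" if "P \<in> pg_points K r" for P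
    using that subspaceD[of P] by (auto simp: pg_subspaces_iff)
  have "card (\<Union>P\<in>?X. P - {?z}) = (\<Sum>P\<in>?X. card (P - {?z}))"
  proof (rule card_UN_disjoint)
    show "\<forall>P\<in>?X. \<forall>Q\<in>?X. P \<noteq> Q \<longrightarrow> (P - {?z}) \<inter> (Q - {?z}) = {}"
      using points_disjoint by blast
  qed (use fX P in auto)
  also have "\<dots> = (\<Sum>P\<in>?X. q - 1)" using P by (intro sum.cong) auto
  also have "(\<Union>P\<in>?X. P - {?z}) = W - {?z}"
  proof (intro equalityI subsetI)
    fix v assume v: "v \<in> W - {?z}"
    hence "pt v \<in> ?X" "v \<in> pt v" using W assms pt_is_point pt_subset mem_pt by auto
    thus "v \<in> (\<Union>P\<in>?X. P - {?z})" using v by blast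
  qed auto
  finally show ?thesis using W by simp
qed

lemma finite_pg_points: "finite (pg_points K r)"
  using finite_W0 pg_subspace_subset by (intro finite_subset[of "pg_points K r" "Pow (carrier W0)"]) blast+

lemma card_pg_points: "card (pg_points K r) * (q - 1) = q ^ (r + 1) - 1"
proof -
  have "subspace K (carrier W0) W0"
    using vs.vectorspace_axioms vs.module_axioms by (auto simp: subspace_def intro!: submodule.intro)
  moreover have "{P \<in> pg_points K r. P \<subseteq> carrier W0} = pg_points K r"
    using pg_subspace_subset by blast
  ultimately show ?thesis using card_points_in_subspace[of "carrier W0"] card_W0 by simp
qed

lemma card_points_on_line:
  assumes "L \<in> pg_lines K r"
  shows "card {P \<in> pg_points K r. P \<subseteq> L} = q + 1"
proof -
  have "card {P \<in> pg_points K r. P \<subseteq> L} * (q - 1) = q ^ 2 - 1"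
    using card_points_in_subspace[of L] assms pg_subspaces_iff[of L 1] by (simp add: power2_eq_square)
  also have "q ^ 2 - 1 = (q + 1) * (q - 1)"
    using q_ge_2 by (simp add: power2_eq_square algebra_simps)
  finally show ?thesis using q_ge_2 by (subst (asm) mult_cancel2) auto
qed

text \<open>The sum of two distinct points has \<open>q^2\<close> vectors, so it is a line; any line
  containing both points contains their sum and has the same size.\<close>

lemma pg_line_iff:
  assumes "P \<in> pg_points K r" "Q \<in> pg_points K r" "P \<noteq> Q"
  shows "L \<in> pg_lines K r \<and> P \<subseteq> L \<and> Q \<subseteq> L \<longleftrightarrow> L = vs.subspace_sum P Q"
proof -
  have P: "subspace K P W0" "card P = q" and Q: "subspace K Q W0" "card Q = q"
    using assms by (auto simp: pg_subspaces_iff)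
  note PD = subspaceD[OF P(1)] and QD = subspaceD[OF Q(1)]
  let ?S = "vs.subspace_sum P Q"
  have sub: "subspace K ?S W0" by (rule vs.sum_is_subspace[OF P(1) Q(1)])
  have S: "?S = (\<lambda>(x,y). x \<oplus>\<^bsub>W0\<^esub> y) ` (P \<times> Q)"
    by (auto simp: vs.submodule_sum_def)
  \<comment> \<open>Two representations of one vector differ by an element of both \<open>P\<close>
    and \<open>Q\<close>, which must be zero.\<close>
  have "inj_on (\<lambda>(x,y). x \<oplus>\<^bsub>W0\<^esub> y) (P \<times> Q)"
  proof (rule inj_onI, clarsimp)
    fix x y x' y' assume A: "x \<in> P" "y \<in> Q" "x' \<in> P" "y' \<in> Q" "x \<oplus>\<^bsub>W0\<^esub> y = x' \<oplus>\<^bsub>W0\<^esub> y'"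
    have C: "x \<in> carrier W0" "y \<in> carrier W0" "x' \<in> carrier W0" "y' \<in> carrier W0"
      using A PD(1) QD(1) by auto
    have neg: "\<ominus>\<^bsub>W0\<^esub> z = (\<ominus> \<one>) \<odot>\<^bsub>W0\<^esub> z" if "z \<in> carrier W0" for z
      using that by (simp add: vs.smult_l_minus)
    have "x \<oplus>\<^bsub>W0\<^esub> \<ominus>\<^bsub>W0\<^esub> x' \<in> P" using A PD neg C by auto
    moreover have "y' \<oplus>\<^bsub>W0\<^esub> \<ominus>\<^bsub>W0\<^esub> y \<in> Q" using A QD neg C by auto
    moreover have "x \<oplus>\<^bsub>W0\<^esub> \<ominus>\<^bsub>W0\<^esub> x' = y' \<oplus>\<^bsub>W0\<^esub> \<ominus>\<^bsub>W0\<^esub> y"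
    proof -
      have cancel: "(a \<oplus>\<^bsub>W0\<^esub> b) \<oplus>\<^bsub>W0\<^esub> (\<ominus>\<^bsub>W0\<^esub> a \<oplus>\<^bsub>W0\<^esub> c) = b \<oplus>\<^bsub>W0\<^esub> c"
        if "a \<in> carrier W0" "b \<in> carrier W0" "c \<in> carrier W0" for a b c
        using that by (simp add: vs.M.a_comm[of a b] vs.M.a_assoc vs.M.r_neg2)
      have "x \<oplus>\<^bsub>W0\<^esub> \<ominus>\<^bsub>W0\<^esub> x' = (x \<oplus>\<^bsub>W0\<^esub> y) \<oplus>\<^bsub>W0\<^esub> (\<ominus>\<^bsub>W0\<^esub> x' \<oplus>\<^bsub>W0\<^esub> \<ominus>\<^bsub>W0\<^esub> y)"
        using cancel[of y x "\<ominus>\<^bsub>W0\<^esub> x'"] C by (simp add: vs.M.a_comm)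
      also have "\<dots> = (x' \<oplus>\<^bsub>W0\<^esub> y') \<oplus>\<^bsub>W0\<^esub> (\<ominus>\<^bsub>W0\<^esub> x' \<oplus>\<^bsub>W0\<^esub> \<ominus>\<^bsub>W0\<^esub> y)" by (simp add: A(5))
      also have "\<dots> = y' \<oplus>\<^bsub>W0\<^esub> \<ominus>\<^bsub>W0\<^esub> y" by (rule cancel) (use C in auto)
      finally show ?thesis .
    qed
    ultimately have "x \<oplus>\<^bsub>W0\<^esub> \<ominus>\<^bsub>W0\<^esub> x' = \<zero>\<^bsub>W0\<^esub>" "y' \<oplus>\<^bsub>W0\<^esub> \<ominus>\<^bsub>W0\<^esub> y = \<zero>\<^bsub>W0\<^esub>"
      using points_disjoint[OF assms] by auto
    thus "x = x' \<and> y = y'"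
      using C vs.M.minus_equality[of x "\<ominus>\<^bsub>W0\<^esub> x'"] vs.M.minus_equality[of y' "\<ominus>\<^bsub>W0\<^esub> y"] by auto
  qed
  hence "card ?S = q * q" by (simp add: S card_image card_cartesian_product P Q)
  hence line: "?S \<in> pg_lines K r" using sub by (simp add: pg_subspaces_iff power2_eq_square)
  have incl: "P \<subseteq> ?S" "Q \<subseteq> ?S"
    using vs.vsum_is_minimal[OF P(1) Q(1) sub] by auto
  show ?thesis
  proof
    assume L: "L \<in> pg_lines K r \<and> P \<subseteq> L \<and> Q \<subseteq> L"
    hence Ls: "subspace K L W0" "card L = q ^ 2" by (auto simp: pg_subspaces_iff power2_eq_square)
    have "?S \<subseteq> L" using vs.vsum_is_minimal[OF P(1) Q(1) Ls(1)] L by auto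
    thus "L = ?S" using card_subset_eq[of L ?S] subspaceD(5)[OF Ls(1)] \<open>card ?S = q * q\<close> Ls
      by (auto simp: power2_eq_square)
  qed (use line incl in auto)
qed

text \<open>A line in the sense of \<open>pg_lines\<close> is a set of vectors; as a line of a
  linear space it has to be replaced by the set of points that it contains.\<close>

definition blocks :: "(nat \<Rightarrow> 'a) set set set" where
  "blocks = (\<lambda>L. {P \<in> pg_points K r. P \<subseteq> L}) ` pg_lines K r"

lemma block_through:
  assumes "P \<in> pg_points K r" "Q \<in> pg_points K r" "P \<noteq> Q"
  shows "\<exists>!b. b \<in> blocks \<and> P \<in> b \<and> Q \<in> b"
proof -
  let ?b = "{R \<in> pg_points K r. R \<subseteq> vs.subspace_sum P Q}"
  have "b \<in> blocks \<and> P \<in> b \<and> Q \<in> b \<longleftrightarrow> b = ?b" for b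
  proof
    assume "b \<in> blocks \<and> P \<in> b \<and> Q \<in> b"
    then obtain L where L: "L \<in> pg_lines K r" "b = {R \<in> pg_points K r. R \<subseteq> L}" "P \<subseteq> L" "Q \<subseteq> L"
      by (auto simp: blocks_def)
    hence "L = vs.subspace_sum P Q" using pg_line_iff[OF assms, of L] by blast
    thus "b = ?b" using L(2) by simp
  next
    assume "b = ?b"
    moreover have "vs.subspace_sum P Q \<in> pg_lines K r \<and> P \<subseteq> vs.subspace_sum P Q \<and> Q \<subseteq> vs.subspace_sum P Q"
      using pg_line_iff[OF assms] by blast
    ultimately show "b \<in> blocks \<and> P \<in> b \<and> Q \<in> b" using assms unfolding blocks_def by blast
  qed
  thus ?thesis by simp
qed

lemma pg_collinear_iff:
  "T \<subseteq> pg_points K r \<Longrightarrow> pg_collinear K r T \<longleftrightarrow> (\<exists>b\<in>blocks. T \<subseteq> b)"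
  by (auto simp: pg_collinear_def blocks_def)

end

text \<open>An elliptic quadric without its point at infinity, as the graph of an anisotropic form.\<close>

lemma (in finite_projective_space) ex_quadric:
  assumes "r = 3"
  shows "\<exists>Q. Q \<subseteq> pg_points K r \<and> card Q = q ^ 2 \<and>
    (\<forall>T. T \<subseteq> Q \<and> card T = 3 \<longrightarrow> \<not> pg_collinear K r T)"
proof -
  obtain c where c: "c \<in> carrier K" "\<forall>t\<in>carrier K. t \<otimes> t \<ominus> t \<ominus> c \<noteq> \<zero>"
    using ex_not_of_form_square_minus_self finite_field by auto
  \<comment> \<open>The affine chart with zeroth coordinate 1, in which the quadric is the graph of
    \<open>qform c\<close> over the plane. This yields \<open>q^2\<close> of its
    \<open>q^2 + 1\<close> points.\<close>
  define v where "v = (\<lambda>(x,y). \<lambda>i\<in>{..3::nat}.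
    if i = 0 then \<one> else if i = 1 then x else if i = 2 then y else qform c x y)"
  have v_simps: "v (x,y) 0 = \<one>" "v (x,y) (Suc 0) = x" "v (x,y) 2 = y" "v (x,y) 3 = qform c x y" for x y
    by (auto simp: v_def)
  have v_carrier: "v z \<in> carrier W0" if "z \<in> carrier K \<times> carrier K" for z
    unfolding carrier_W0 using that c assms by (auto simp: v_def split: if_splits)
  have smult: "(a \<odot>\<^bsub>W0\<^esub> u) i = a \<otimes> u i" if "i \<le> 3" for a u i
    using that assms by (simp add: func_space_def)
  have add: "(u \<oplus>\<^bsub>W0\<^esub> w) i = u i \<oplus> w i" if "i \<le> 3" for u w i
    using that assms by (simp add: func_space_def)
  have zero: "\<zero>\<^bsub>W0\<^esub> i = \<zero>" if "i \<le> 3" for i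
    using that assms by (simp add: func_space_def)
  have v_ne: "v z \<noteq> \<zero>\<^bsub>W0\<^esub>" for z
    using zero[of 0] v_simps(1) by (cases z) (metis zero_le zero_not_one)
  have pt_v: "pt (v z) \<in> pg_points K r" if "z \<in> carrier K \<times> carrier K" for z
    using pt_is_point v_ne v_carrier that by auto
  have inj: "inj_on (\<lambda>z. pt (v z)) (carrier K \<times> carrier K)"
  proof (rule inj_onI)
    fix z z' assume z: "z \<in> carrier K \<times> carrier K" "z' \<in> carrier K \<times> carrier K" "pt (v z) = pt (v z')"
    obtain x y x' y' where [simp]: "z = (x,y)" "z' = (x',y')" by fastforce
    have "v z \<in> pt (v z')" using z mem_pt v_carrier by metis
    then obtain a where a: "a \<in> carrier K" "v z = a \<odot>\<^bsub>W0\<^esub> v z'" by (auto simp: pt_def)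
    have coord: "v (x,y) i = a \<otimes> v (x',y') i" if "i \<le> 3" for i
      using smult[OF that, of a "v z'"] a(2) by simp
    have "a = \<one>" using coord[of 0] a(1) by (simp add: v_simps)
    thus "z = z'" using coord[of "Suc 0"] coord[of 2] z by (simp add: v_simps)
  qed
  let ?Q = "(\<lambda>z. pt (v z)) ` (carrier K \<times> carrier K)"
  have "card ?Q = q ^ 2"
    by (simp add: card_image[OF inj] card_cartesian_product card_field power2_eq_square)
  moreover have "?Q \<subseteq> pg_points K r" using pt_v by auto
  moreover have False if T: "T \<subseteq> ?Q" "card T = 3" "pg_collinear K r T" for T
  proof -
    obtain P1 P2 P3 where P: "T = {P1,P2,P3}" "P1 \<noteq> P2" "P1 \<noteq> P3" "P2 \<noteq> P3"
      using T(2) by (auto simp: card_3_iff)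
    obtain x1 y1 x2 y2 x3 y3 where
      car: "x1 \<in> carrier K" "y1 \<in> carrier K" "x2 \<in> carrier K" "y2 \<in> carrier K" "x3 \<in> carrier K" "y3 \<in> carrier K"
      and P_eq: "P1 = pt (v (x1,y1))" "P2 = pt (v (x2,y2))" "P3 = pt (v (x3,y3))"
      using T(1) P(1) by auto
    note [simp] = car c(1)
    have pts: "P1 \<in> pg_points K r" "P2 \<in> pg_points K r" using pt_v P_eq by auto
    obtain L where L: "L \<in> pg_lines K r" "P1 \<subseteq> L" "P2 \<subseteq> L" "P3 \<subseteq> L"
      using T(3) P(1) by (auto simp: pg_collinear_def)
    hence "L = vs.subspace_sum P1 P2" using pg_line_iff[OF pts P(2), of L] by blast
    hence "P3 \<subseteq> vs.subspace_sum P1 P2" using L(4) by simp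
    moreover have "v (x3,y3) \<in> P3" using P_eq mem_pt v_carrier by auto
    ultimately obtain u w where uw: "u \<in> P1" "w \<in> P2" "v (x3,y3) = u \<oplus>\<^bsub>W0\<^esub> w"
      by (auto simp: vs.submodule_sum_def)
    then obtain a b where ab [simp]: "a \<in> carrier K" "b \<in> carrier K"
      and v3: "v (x3,y3) = (a \<odot>\<^bsub>W0\<^esub> v (x1,y1)) \<oplus>\<^bsub>W0\<^esub> (b \<odot>\<^bsub>W0\<^esub> v (x2,y2))"
      unfolding P_eq pt_def by auto
    have coord: "v (x3,y3) i = a \<otimes> v (x1,y1) i \<oplus> b \<otimes> v (x2,y2) i" if "i \<le> 3" for i
      using v3 add[OF that] smult[OF that] by metis
    \<comment> \<open>The normalised zeroth coordinates force an affine combination, so the third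
      point is the one with parameter \<open>b\<close> on the affine line through the first
      two.\<close>
    have "\<one> = a \<oplus> b" using coord[of 0] by (simp add: v_simps)
    hence a: "a = \<one> \<ominus> b" by (simp add: a_minus_def a_assoc r_neg)
    have x3: "x3 = (\<one> \<ominus> b) \<otimes> x1 \<oplus> b \<otimes> x2" and y3: "y3 = (\<one> \<ominus> b) \<otimes> y1 \<oplus> b \<otimes> y2"
      and z3: "qform c x3 y3 = (\<one> \<ominus> b) \<otimes> qform c x1 y1 \<oplus> b \<otimes> qform c x2 y2"
      using coord[of "Suc 0"] coord[of 2] coord[of 3] by (simp_all only: v_simps a)
    define d e where "d = x2 \<ominus> x1" and "e = y2 \<ominus> y1"
    have [simp]: "d \<in> carrier K" "e \<in> carrier K" by (auto simp: d_def e_def)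
    \<comment> \<open>The factor \<open>\<one>\<close> is kept so that the expansion along the line
      also applies at parameter 1.\<close>
    have x2: "x2 = x1 \<oplus> \<one> \<otimes> d" and y2: "y2 = y1 \<oplus> \<one> \<otimes> e"
      by (simp_all add: d_def e_def a_minus_def a_lcomm[of x1 x2] a_lcomm[of y1 y2] r_neg)
    have line: "(\<one> \<ominus> b) \<otimes> x \<oplus> b \<otimes> (x \<oplus> \<one> \<otimes> z) = x \<oplus> b \<otimes> z"
      if "x \<in> carrier K" "z \<in> carrier K" for x z
      using that by (simp add: a_minus_def l_distr r_distr l_minus a_assoc r_neg1 r_neg2)
    define B where "B = x1 \<otimes> d \<oplus> d \<otimes> x1 \<ominus> (x1 \<otimes> e \<oplus> d \<otimes> y1) \<ominus> c \<otimes> (y1 \<otimes> e \<oplus> e \<otimes> y1)"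
    have [simp]: "B \<in> carrier K" by (simp add: B_def)
    \<comment> \<open>The last coordinate is computed twice: as a quadratic polynomial in
      \<open>b\<close> from the form, and as linear interpolation from collinearity. The difference
      is \<open>b * (1 - b) * qform c d e\<close> up to sign.\<close>
    have "qform c x1 y1 \<oplus> b \<otimes> B \<oplus> b \<otimes> b \<otimes> qform c d e = qform c x3 y3"
      unfolding x3 y3 x2 y2 by (simp only: line car \<open>d \<in> carrier K\<close> \<open>e \<in> carrier K\<close>)
        (simp add: qform_add_smult B_def)
    also have "\<dots> = (\<one> \<ominus> b) \<otimes> qform c x1 y1 \<oplus> b \<otimes> (qform c x1 y1 \<oplus> \<one> \<otimes> (B \<oplus> qform c d e))"
      unfolding z3 by (subst x2, subst y2, subst qform_add_smult) (auto simp: B_def a_assoc)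
    also have "\<dots> = qform c x1 y1 \<oplus> b \<otimes> (B \<oplus> qform c d e)" by (rule line) auto
    also have "\<dots> = qform c x1 y1 \<oplus> b \<otimes> B \<oplus> b \<otimes> qform c d e" by (simp add: r_distr a_assoc)
    finally have eq: "qform c x1 y1 \<oplus> b \<otimes> B \<oplus> b \<otimes> b \<otimes> qform c d e =
        qform c x1 y1 \<oplus> b \<otimes> B \<oplus> b \<otimes> qform c d e" .
    have cancel: "u = w" if "z \<oplus> u = z \<oplus> w" "u \<in> carrier K" "w \<in> carrier K" "z \<in> carrier K" for u w z
      using that by (metis r_neg1)
    have "qform c d e \<in> carrier K" by simp
    hence "b \<otimes> b \<otimes> qform c d e = b \<otimes> qform c d e" by (intro cancel[OF eq]) auto
    hence "b \<otimes> (\<one> \<ominus> b) \<otimes> qform c d e = \<zero>"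
      by (simp add: a_minus_def l_distr r_distr r_minus l_minus r_neg)
    \<comment> \<open>Each factor being zero makes two of the three points coincide.\<close>
    hence "b = \<zero> \<or> \<one> \<ominus> b = \<zero> \<or> qform c d e = \<zero>" by (auto simp add: integral_iff)
    thus False
    proof (elim disjE)
      assume "b = \<zero>"
      hence "x3 = x1" "y3 = y1" using x3 y3 by (simp_all add: a_minus_def)
      thus False using P(3) P_eq by simp
    next
      assume b: "\<one> \<ominus> b = \<zero>"
      hence "b = \<one>" by (simp add: r_right_minus_eq)
      hence "x3 = x2" "y3 = y2" using x3 y3 by (simp_all add: a_minus_def r_neg)
      thus False using P(4) P_eq by simp
    next
      assume "qform c d e = \<zero>"
      hence "d = \<zero> \<and> e = \<zero>" by (intro qform_anisotropic[OF c]) auto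
      thus False using P(2) P_eq by (simp add: d_def e_def)
    qed
  qed
  ultimately show ?thesis by blast
qed

section \<open>Caps in random sets of points\<close>

context finite_projective_space
begin

sublocale linear_space "pg_points K r" blocks q
proof
  show "\<And>L. L \<in> blocks \<Longrightarrow> card L = q + 1"
    using card_points_on_line by (auto simp: blocks_def)
qed (use finite_pg_points q_ge_2 block_through in \<open>auto simp: blocks_def\<close>)

lemma independence_number_eq:
  assumes "S \<subseteq> pg_points K r"
  shows "independence_number (collinear_triples K r S) = cap_number S"
proof -
  have "(\<forall>e\<in>{T. T \<subseteq> S \<and> card T = 3 \<and> pg_collinear K r T}. \<not> e \<subseteq> I) \<longleftrightarrow> cap I"
    if "I \<subseteq> S" for I
  proof -
    have I: "I \<subseteq> pg_points K r" using that assms by blast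
    hence "pg_collinear K r T \<longleftrightarrow> (\<exists>b\<in>blocks. T \<subseteq> b)" if "T \<subseteq> I" for T
      using that by (intro pg_collinear_iff) blast
    moreover have "(\<forall>e\<in>{T. T \<subseteq> S \<and> card T = 3 \<and> pg_collinear K r T}. \<not> e \<subseteq> I) \<longleftrightarrow>
        (\<forall>T. T \<subseteq> I \<and> card T = 3 \<longrightarrow> \<not> pg_collinear K r T)"
      using that by blast
    ultimately show ?thesis using I unfolding cap_def by simp
  qed
  hence "{I. I \<subseteq> S \<and> (\<forall>e\<in>{T. T \<subseteq> S \<and> card T = 3 \<and> pg_collinear K r T}. \<not> e \<subseteq> I)} =
      {I. I \<subseteq> S \<and> cap I}" by auto
  thus ?thesis
    by (simp add: independence_number_def cap_number_def collinear_triples_def)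
qed

text \<open>Moves every probability to the random point set. The event is intersected with the
  support because the identification with caps holds for sets of points only.\<close>

lemma prob_independence_number:
  "measure_pmf.prob (random_collinear_triples K r p) {H. E (independence_number H)} =
   measure_pmf.prob (random_subset (pg_points K r) p) {S. E (cap_number S)}"
proof -
  let ?M = "random_subset (pg_points K r) p"
  have "random_collinear_triples K r p = map_pmf (collinear_triples K r) ?M"
    by (simp add: random_collinear_triples_def random_subset_def map_pmf_comp)
  hence "measure_pmf.prob (random_collinear_triples K r p) {H. E (independence_number H)} =
      measure_pmf.prob ?M ({S. E (independence_number (collinear_triples K r S))} \<inter> set_pmf ?M)"
    by (simp add: measure_Int_set_pmf vimage_def)
  also have "{S. E (independence_number (collinear_triples K r S))} \<inter> set_pmf ?M =
      {S. E (cap_number S)} \<inter> set_pmf ?M"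
    by (auto simp: independence_number_eq[OF set_random_subset])
  finally show ?thesis by (simp add: measure_Int_set_pmf)
qed

lemma pencil_size_mult: "pencil_size * (q - 1) = q ^ r - 1"
  and card_pg_points_eq: "card (pg_points K r) = q ^ r + pencil_size"
  and pencil_size_mult_q: "card (pg_points K r) = pencil_size * q + 1"
proof -
  \<comment> \<open>The geometric sum \<open>1 + q + ... + q^(r-1)\<close>, which turns out to be
    the pencil size.\<close>
  define m where "m = (\<Sum>i<r. q ^ i)"
  have m: "m * (q - 1) + 1 = q ^ r"
  proof -
    have "int m * (int q - 1) = int q ^ r - 1"
      using power_diff_1_eq[of "int q" r] by (simp add: m_def mult.commute)
    hence "int (m * (q - 1) + 1) = int (q ^ r)" using q_ge_2 by (simp add: of_nat_diff)
    thus ?thesis by (simp only: of_nat_eq_iff)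
  qed
  have mq: "m * q = m * (q - 1) + m" using q_ge_2 by (cases q) auto
  have "(m + q ^ r) * (q - 1) = q ^ (r + 1) - 1"
  proof -
    have "q ^ r * (q - 1) + q ^ r = q ^ (r + 1)" using q_ge_2 by (cases q) auto
    thus ?thesis using m by (simp add: add_mult_distrib)
  qed
  hence N: "card (pg_points K r) = q ^ r + m"
    using card_pg_points q_ge_2 by (metis add.commute diff_is_0_eq mult_cancel2 not_less_eq_eq numeral_2_eq_2 One_nat_def)
  have "card (pg_points K r) = m * q + 1" using N m mq by simp
  moreover from this have "pencil_size = m" using q_ge_2 by (simp add: pencil_size_def)
  ultimately show "pencil_size * (q - 1) = q ^ r - 1"
    "card (pg_points K r) = q ^ r + pencil_size"
    "card (pg_points K r) = pencil_size * q + 1"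
    using N m by auto
qed

lemma pencil_size_le:
  assumes "r \<ge> 1"
  shows "pencil_size \<le> 2 * q ^ (r - 1)"
proof -
  have "pencil_size * (q - 1) \<le> q * q ^ (r - 1)"
    using pencil_size_mult assms by (simp flip: power_Suc)
  also have "\<dots> \<le> (2 * (q - 1)) * q ^ (r - 1)" using q_ge_2 by (intro mult_right_mono) auto
  finally have "pencil_size * (q - 1) \<le> (2 * q ^ (r - 1)) * (q - 1)" by (simp add: mult_ac)
  thus ?thesis using q_ge_2 by simp
qed

lemma pencil_size_pos: "r \<ge> 1 \<Longrightarrow> pencil_size > 0"
  using pencil_size_mult q_ge_2 one_less_power[of q r] by (cases "pencil_size = 0") auto

lemma card_pg_points_bounds:
  assumes "r \<ge> 1"
  shows "q ^ r \<le> card (pg_points K r)" "card (pg_points K r) \<le> 2 * q ^ r"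
proof -
  show "q ^ r \<le> card (pg_points K r)" by (simp add: card_pg_points_eq)
  have "pencil_size * 1 \<le> pencil_size * (q - 1)" using q_ge_2 by (intro mult_left_mono) auto
  also have "\<dots> \<le> q ^ r" by (simp only: pencil_size_mult diff_le_self)
  finally have "pencil_size \<le> q ^ r" by simp
  thus "card (pg_points K r) \<le> 2 * q ^ r" by (simp add: card_pg_points_eq)
qed

text \<open>The cap number lies between \<open>card S\<close> minus the number of collinear triples
  and \<open>card S\<close>. The two errors, each below \<open>\<epsilon> * p * N\<close>, account
  for \<open>4 * \<epsilon>\<close> since \<open>N \<le> 2 * q^r\<close>; the term
  \<open>2 / q\<close> pays for the difference between \<open>N\<close> and
  \<open>q^r\<close>.\<close>

lemma prob_independence_number_deviation:
  assumes r: "r \<ge> 1" and p: "0 < p" "p \<le> 1" and \<epsilon>: "0 < \<epsilon>"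
  shows "measure_pmf.prob (random_collinear_triples K r p)
      {H. \<not> \<bar>real (independence_number H) - p * real q ^ r\<bar> \<le> (4 * \<epsilon> + 2 / q) * (p * real q ^ r)}
    \<le> 1 / (\<epsilon>\<^sup>2 * (p * real q ^ r)) + 4 * (p\<^sup>2 * real q ^ (r + 1)) / \<epsilon>"
proof -
  let ?V = "pg_points K r" and ?M = "random_subset (pg_points K r) p"
  define N where "N = real (card ?V)"
  have Q: "real q ^ r > 0" "real q \<ge> 2" using q_ge_2 by auto
  have N: "real q ^ r \<le> N" "N \<le> 2 * real q ^ r" "N > 0"
  proof -
    show 1: "real q ^ r \<le> N" using card_pg_points_bounds(1)[OF r] unfolding N_def
      by (metis of_nat_le_iff of_nat_power)
    have "N \<le> real (2 * q ^ r)" using card_pg_points_bounds(2)[OF r] unfolding N_def of_nat_le_iff .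
    thus "N \<le> 2 * real q ^ r" by simp
    show "N > 0" using 1 Q by linarith
  qed
  have M: "real pencil_size \<le> 2 / q * real q ^ r"
  proof -
    have "real pencil_size \<le> real (2 * q ^ (r - 1))" using pencil_size_le[OF r] unfolding of_nat_le_iff .
    also have "\<dots> = 2 / q * real q ^ r" using Q r by (cases r) auto
    finally show ?thesis .
  qed
  define d where "d = \<epsilon> * (p * N)"
  have d: "d > 0" using \<epsilon> p N by (simp add: d_def)
  let ?bad1 = "{S. d \<le> \<bar>real (card (S \<inter> ?V)) - p * real (card ?V)\<bar>}"
  let ?bad2 = "{S. d \<le> real (card {T \<in> triples. T \<subseteq> S})}"
  have b1: "measure_pmf.prob ?M ?bad1 \<le> 1 / (\<epsilon>\<^sup>2 * (p * real q ^ r))"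
  proof -
    have "measure_pmf.prob ?M ?bad1 \<le> p * N / d\<^sup>2"
      unfolding N_def using prob_card_Int_deviation[of ?V ?V p d] p d finite_pg_points by simp
    also have "\<dots> = 1 / (\<epsilon>\<^sup>2 * (p * N))"
      using \<epsilon> p N by (simp add: d_def power2_eq_square field_simps)
    also have "\<dots> \<le> 1 / (\<epsilon>\<^sup>2 * (p * real q ^ r))"
      using \<epsilon> p Q by (intro divide_left_mono mult_left_mono mult_pos_pos N(1) N(3)) auto
    finally show ?thesis .
  qed
  have b2: "measure_pmf.prob ?M ?bad2 \<le> 4 * (p\<^sup>2 * real q ^ (r + 1)) / \<epsilon>"
  proof -
    \<comment> \<open>Relative to the \<open>p * N\<close> expected points, the expected number of
      triples is at most \<open>N * (q + 1) * p^2\<close>.\<close>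
    have "measure_pmf.prob ?M ?bad2 \<le> real (card triples) * p ^ 3 / d"
      using p d finite_pg_points by (intro prob_card_contained_ge) (auto simp: triples_def)
    also have "\<dots> \<le> (N ^ 2 * (real q + 1)) * p ^ 3 / d"
    proof -
      have "real (card triples) \<le> real (card ?V ^ 2 * (q + 1))"
        using card_triples_le unfolding of_nat_le_iff .
      also have "\<dots> = N ^ 2 * (real q + 1)" by (simp add: N_def algebra_simps)
      finally show ?thesis using p d by (intro divide_right_mono mult_right_mono) auto
    qed
    also have "\<dots> = N * (real q + 1) * p ^ 2 / \<epsilon>"
      using \<epsilon> p N by (simp add: d_def power2_eq_square power3_eq_cube field_simps)
    also have "\<dots> \<le> (2 * real q ^ r) * (2 * real q) * p ^ 2 / \<epsilon>"
      using \<epsilon> p N Q by (intro divide_right_mono mult_right_mono mult_mono) auto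
    finally show ?thesis by (simp add: mult_ac)
  qed
  have "{S. \<not> \<bar>real (cap_number S) - p * real q ^ r\<bar> \<le> (4 * \<epsilon> + 2 / q) * (p * real q ^ r)} \<inter> set_pmf ?M
      \<subseteq> ?bad1 \<union> ?bad2"
  proof (rule ccontr)
    assume "\<not> ?thesis"
    then obtain S where S: "S \<in> set_pmf ?M" "S \<notin> ?bad1" "S \<notin> ?bad2"
      and far: "\<not> \<bar>real (cap_number S) - p * real q ^ r\<bar> \<le> (4 * \<epsilon> + 2 / q) * (p * real q ^ r)"
      by blast
    have SV: "S \<subseteq> ?V" using S(1) by (rule set_random_subset)
    hence fS: "finite S" "S \<inter> ?V = S" using finite_pg_points by (auto intro: finite_subset)
    have 1: "\<bar>real (card S) - p * N\<bar> < d" using S(2) fS by (simp add: N_def)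
    have 2: "real (card {T \<in> triples. T \<subseteq> S}) < d" using S(3) by simp
    have 3: "real (cap_number S) \<le> card S" using cap_number_le_card[OF fS(1)] by simp
    have 4: "real (card S) \<le> cap_number S + real (card {T \<in> triples. T \<subseteq> S})"
      using cap_number_ge_deletion[OF SV] by linarith
    have pN: "p * N = p * real q ^ r + p * pencil_size"
      using card_pg_points_eq by (simp add: N_def algebra_simps)
    have pM: "p * pencil_size \<le> 2 / q * (p * real q ^ r)" "0 \<le> p * pencil_size"
      using mult_left_mono[OF M, of p] p by (auto simp: mult_ac)
    have dN: "2 * d \<le> 4 * \<epsilon> * (p * real q ^ r)"
      using mult_left_mono[OF N(2), of "2 * \<epsilon> * p"] \<epsilon> p by (simp add: d_def mult_ac)
    have "\<bar>real (cap_number S) - p * real q ^ r\<bar> \<le> 4 * \<epsilon> * (p * real q ^ r) + 2 / q * (p * real q ^ r)"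
      using 1 2 3 4 pN pM dN d by linarith
    thus False using far by (simp add: distrib_right)
  qed
  hence "measure_pmf.prob ?M {S. \<not> \<bar>real (cap_number S) - p * real q ^ r\<bar> \<le> (4 * \<epsilon> + 2 / q) * (p * real q ^ r)}
      \<le> measure_pmf.prob ?M (?bad1 \<union> ?bad2)"
    by (subst measure_Int_set_pmf[symmetric]) (intro measure_pmf.finite_measure_mono, auto)
  also have "\<dots> \<le> measure_pmf.prob ?M ?bad1 + measure_pmf.prob ?M ?bad2"
    by (intro measure_Un_le) auto
  also have "\<dots> \<le> 1 / (\<epsilon>\<^sup>2 * (p * real q ^ r)) + 4 * (p\<^sup>2 * real q ^ (r + 1)) / \<epsilon>"
    by (rule add_mono[OF b1 b2])
  finally show ?thesis
    using prob_independence_number[of p "\<lambda>n. \<not> \<bar>real n - p * real q ^ r\<bar> \<le> (4 * \<epsilon> + 2 / q) * (p * real q ^ r)"]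
    by simp
qed

lemma prob_independence_number_mono:
  assumes "0 \<le> p" "p \<le> p'" "p' \<le> 1"
  shows "measure_pmf.prob (random_collinear_triples K r p) {H. x \<le> real (independence_number H)}
    \<le> measure_pmf.prob (random_collinear_triples K r p') {H. x \<le> real (independence_number H)}"
proof -
  have "measure_pmf.prob (random_subset (pg_points K r) p) {S. x \<le> real (cap_number S)}
    \<le> measure_pmf.prob (random_subset (pg_points K r) p') {S. x \<le> real (cap_number S)}"
    using assms finite_pg_points cap_number_mono
    by (intro prob_random_subset_mono) (auto, meson of_nat_mono order_trans)
  thus ?thesis
    using prob_independence_number[of p "\<lambda>n. x \<le> real n"] prob_independence_number[of p' "\<lambda>n. x \<le> real n"]
    by simp
qed

text \<open>The chosen points on a fixed quadric form a cap; Chebyshev with deviation half the mean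
  gives the constants 1/2 and 4.\<close>

lemma prob_independence_number_quadric:
  assumes "r = 3" "0 < p" "p \<le> 1"
  shows "measure_pmf.prob (random_collinear_triples K r p)
      {H. \<not> 1 / 2 * (p * real q ^ 2) \<le> real (independence_number H)} \<le> 4 / (p * real q ^ 2)"
proof -
  let ?V = "pg_points K r" and ?M = "random_subset (pg_points K r) p"
  obtain Q where Q: "Q \<subseteq> ?V" "card Q = q ^ 2"
    and nc: "\<forall>T. T \<subseteq> Q \<and> card T = 3 \<longrightarrow> \<not> pg_collinear K r T"
    using ex_quadric[OF assms(1)] by blast
  have capQ: "cap Q" using Q nc unfolding cap_def by (metis pg_collinear_iff subset_trans)
  define d where "d = p * real q ^ 2 / 2"
  have q2: "real q ^ 2 > 0" using q_ge_2 by simp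
  have d: "d > 0" using assms q2 by (simp add: d_def)
  have "measure_pmf.prob ?M {S. \<not> 1 / 2 * (p * real q ^ 2) \<le> real (cap_number S)}
      \<le> measure_pmf.prob ?M {S. d \<le> \<bar>real (card (S \<inter> Q)) - p * real (card Q)\<bar>}"
  proof (intro measure_pmf.finite_measure_mono subsetI)
    fix S assume "S \<in> {S. \<not> 1 / 2 * (p * real q ^ 2) \<le> real (cap_number S)}"
    moreover have "card (S \<inter> Q) \<le> cap_number S"
      using cap_subset[OF capQ] by (intro card_le_cap_number) auto
    hence "real (card (S \<inter> Q)) \<le> real (cap_number S)" by simp
    moreover have "p * real (card Q) = 2 * d" using Q by (simp add: d_def)
    moreover have "1 / 2 * (p * real q ^ 2) = d" by (simp add: d_def)
    ultimately show "S \<in> {S. d \<le> \<bar>real (card (S \<inter> Q)) - p * real (card Q)\<bar>}"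
      unfolding mem_Collect_eq by linarith
  qed auto
  also have "\<dots> \<le> p * real (card Q) / d\<^sup>2"
    using assms d Q finite_pg_points by (intro prob_card_Int_deviation) auto
  also have "\<dots> = 4 / (p * real q ^ 2)"
    using assms q2 Q by (simp add: d_def power2_eq_square field_simps)
  finally show ?thesis
    using prob_independence_number[of p "\<lambda>n. \<not> 1 / 2 * (p * real q ^ 2) \<le> real n"] by simp
qed

text \<open>Here \<open>b\<close> dominates both exponents in the first moment: the cost
  \<open>p q^(r-1)\<close> of the free points and the cost \<open>q^((r-1)/2) ln^2 q\<close> of the
  choices.\<close>

lemma prob_independence_number_large:
  assumes r: "r \<ge> 1" and p: "0 \<le> p" "p \<le> 1" and q: "8 \<le> ln (real q)"
    and B: "p * real q ^ (r - 1) \<le> b" "real q powr ((real r - 1) / 2) * (ln (real q))\<^sup>2 \<le> b"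
  shows "measure_pmf.prob (random_collinear_triples K r p)
      {H. \<not> real (independence_number H) \<le> (4 * real r + 29) * b} \<le> exp (- b)"
proof -
  let ?V = "pg_points K r" and ?M = "random_subset (pg_points K r) p"
  define Q where "Q = real q"
  define l where "l = ln Q"
  have Q2: "Q \<ge> 2" using q_ge_2 by (simp add: Q_def)
  have l8: "l \<ge> 8" using q by (simp add: l_def Q_def)
  define Y where "Y = Q powr ((real r - 1) / 2) * l"
  define X where "X = Y * l"
  \<comment> \<open>\<open>t\<close> serves both as the size of the fixed subset and as the number
    of branching steps.\<close>
  define t where "t = nat \<lceil>Y\<rceil>"
  \<comment> \<open>The constant is \<open>12 + 4 * (r + 4) + 1\<close>: the free points, the
    choices, and a surplus that leaves \<open>exp (- b)\<close>.\<close>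
  define m where "m = nat \<lceil>(4 * real r + 29) * b\<rceil>"
  define P where "P = real pencil_size"
  have Q1: "Q powr ((real r - 1) / 2) \<ge> 1" using Q2 r by (intro ge_one_powr_ge_zero) auto
  have Y1: "Y \<ge> 1" using Q1 l8 mult_mono[of 1 "Q powr ((real r - 1) / 2)" 1 l] by (simp add: Y_def)
  have X: "X \<le> b" using B(2) by (simp add: X_def Y_def l_def Q_def power2_eq_square mult_ac)
  have X2: "2 * Y \<le> X" using Y1 l8 mult_mono[of Y Y 2 l] by (simp add: X_def)
  have t: "Y \<le> t" "t \<le> 2 * Y" using Y1 by (auto simp: t_def) linarith+
  have b0: "b \<ge> 0" using X X2 Y1 by linarith
  have m: "(4 * real r + 29) * b \<le> m" using b0 by (simp add: m_def)
  have Yb: "2 * Y \<le> (4 * real r + 29) * b"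
  proof -
    have "1 * b \<le> (4 * real r + 29) * b" using b0 by (intro mult_right_mono) auto
    thus ?thesis using X X2 by linarith
  qed
  have tm: "t \<le> m" using t(2) Yb m by linarith
  have P0: "P > 0" using pencil_size_pos[OF r] by (simp add: P_def)
  have P2: "P \<le> 2 * Q ^ (r - 1)"
    using pencil_size_le[OF r] unfolding P_def Q_def by (metis of_nat_le_iff of_nat_mult of_nat_numeral of_nat_power)
  have N: "real (card ?V) = P * Q + 1"
    using pencil_size_mult_q by (simp add: P_def Q_def)
  have Ysq: "Y ^ 2 = Q ^ (r - 1) * l ^ 2"
  proof -
    have "(Q powr ((real r - 1) / 2)) ^ 2 = Q powr (real r - 1)"
      using Q2 by (simp add: power2_eq_square flip: powr_add)
    also have "\<dots> = Q ^ (r - 1)" using Q2 r powr_realpow[of Q "r - 1"] by (simp add: of_nat_diff)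
    finally show ?thesis by (simp add: Y_def power_mult_distrib)
  qed
  \<comment> \<open>The choice of \<open>Y\<close> makes \<open>t^2 \<ge> 4 * P * l\<close>, so
    \<open>t\<close> steps shrink the point set by a factor of at least \<open>Q\<close>, to at most
    \<open>2 * P\<close>. One factor \<open>l\<close> absorbs the constants, hence
    \<open>l \<ge> 8\<close>.\<close>
  have "4 * P * l \<le> 8 * Q ^ (r - 1) * l" using P2 l8 by (intro mult_right_mono) auto
  also have "\<dots> = Q ^ (r - 1) * (8 * l)" by simp
  also have "\<dots> \<le> Q ^ (r - 1) * (l * l)" using l8 Q2 by (intro mult_left_mono mult_right_mono) auto
  also have "\<dots> = Y ^ 2" by (simp only: Ysq power2_eq_square[of l])
  also have "\<dots> \<le> real t ^ 2" using t Y1 by (intro power_mono) auto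
  finally have "l \<le> real t * t / (4 * P)" using P0 by (simp add: field_simps power2_eq_square)
  hence "exp (- (real t * t / (4 * P))) \<le> exp (- l)" by simp
  also have "\<dots> = 1 / Q" using Q2 by (simp add: l_def exp_minus field_simps)
  finally have "real (card ?V) * exp (- (real t * t / (4 * P))) \<le> real (card ?V) * (1 / Q)"
    by (intro mult_left_mono) auto
  also have "\<dots> \<le> 2 * P"
  proof -
    have "1 * 1 \<le> P * Q" using P0 Q2 pencil_size_pos[OF r] by (intro mult_mono) (auto simp: P_def)
    thus ?thesis using N Q2 by (simp add: field_simps)
  qed
  finally have kw: "real (card ?V) * exp (- (real t * t / (4 * pencil_size))) \<le> real (2 * pencil_size)"
    by (simp add: P_def)
  have "measure_pmf.prob ?M {S. \<not> real (cap_number S) \<le> (4 * real r + 29) * b}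
      \<le> measure_pmf.prob ?M {S. \<exists>I. cap I \<and> card I = m \<and> I \<subseteq> S}"
  proof (intro measure_pmf.finite_measure_mono subsetI)
    fix S assume "S \<in> {S. \<not> real (cap_number S) \<le> (4 * real r + 29) * b}"
    hence "m \<le> cap_number S" by (simp add: m_def not_le ceiling_le_iff nat_le_iff)
    then obtain I where "cap I" "I \<subseteq> S" "card I = m" by (rule ex_cap_of_card)
    thus "S \<in> {S. \<exists>I. cap I \<and> card I = m \<and> I \<subseteq> S}" by blast
  qed auto
  also have "\<dots> \<le> exp (6 * p * pencil_size - m) * (3 * (card ?V + 1)) ^ (t + t)"
    using prob_ex_cap_le[OF tm p] kw by simp
  \<comment> \<open>Each of the \<open>t + t\<close> choices costs at most
    \<open>9 * Q^r \<le> Q^(r+4)\<close>, and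
    \<open>t * l \<le> 2 * Y * l = 2 * X \<le> 2 * b\<close>.\<close>
  also have "real ((3 * (card ?V + 1)) ^ (t + t)) \<le> exp (4 * (real r + 4) * b)"
  proof -
    have "real (card ?V) \<le> 2 * Q ^ r"
      using card_pg_points_bounds(2)[OF r] unfolding Q_def by (metis of_nat_le_iff of_nat_mult of_nat_numeral of_nat_power)
    moreover have "1 \<le> Q ^ r" using Q2 by (intro one_le_power) auto
    ultimately have "real (3 * (card ?V + 1)) \<le> 9 * Q ^ r" by simp
    also have "\<dots> \<le> Q ^ 4 * Q ^ r"
    proof -
      have "(2::real) ^ 4 \<le> Q ^ 4" using Q2 by (intro power_mono) auto
      thus ?thesis using Q2 by (intro mult_right_mono) auto
    qed
    also have "\<dots> = exp ((real r + 4) * l)"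
    proof -
      have "Q ^ 4 * Q ^ r = exp l ^ (r + 4)" using Q2 by (simp add: l_def power_add mult_ac)
      also have "\<dots> = exp (real (r + 4) * l)" by (rule exp_of_nat_mult[symmetric])
      finally show ?thesis by simp
    qed
    finally have "real (3 * (card ?V + 1)) ^ (t + t) \<le> exp ((real r + 4) * l) ^ (t + t)"
      by (intro power_mono) auto
    also have "\<dots> = exp (real (t + t) * ((real r + 4) * l))" by (rule exp_of_nat_mult[symmetric])
    also have "\<dots> \<le> exp (4 * (real r + 4) * b)"
    proof -
      have "real (t + t) * ((real r + 4) * l) \<le> (4 * Y) * ((real r + 4) * l)"
        using t l8 by (intro mult_right_mono) auto
      also have "\<dots> = 4 * (real r + 4) * X" by (simp add: X_def mult_ac)
      also have "\<dots> \<le> 4 * (real r + 4) * b" using X by (intro mult_left_mono) auto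
      finally show ?thesis by simp
    qed
    finally show ?thesis by simp
  qed
  also have "exp (6 * p * pencil_size - m) \<le> exp (12 * b - (4 * real r + 29) * b)"
  proof -
    have "6 * p * P \<le> 6 * p * (2 * Q ^ (r - 1))" using P2 p by (intro mult_left_mono) auto
    also have "\<dots> \<le> 12 * b" using B(1) by (simp add: Q_def)
    finally show ?thesis using m by (simp add: P_def)
  qed
  also have "exp (12 * b - (4 * real r + 29) * b) * exp (4 * (real r + 4) * b) = exp (- b)"
    by (simp add: algebra_simps flip: exp_add)
  finally show ?thesis
    using prob_independence_number[of p "\<lambda>n. \<not> real n \<le> (4 * real r + 29) * b"] by simp
qed

end

section \<open>Asymptotics\<close>

lemma eventually_primepow_at_top:
  "eventually P primepow_at_top \<longleftrightarrow> eventually (\<lambda>q. primepow q \<longrightarrow> P q) at_top"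
  by (simp add: primepow_at_top_def eventually_inf_principal)

lemma tendsto_primepow_at_top: "(f \<longlongrightarrow> c) at_top \<Longrightarrow> (f \<longlongrightarrow> c) primepow_at_top"
  by (rule tendsto_mono[of _ at_top]) (auto simp: primepow_at_top_def)

lemma eventually_primepow: "eventually primepow primepow_at_top"
  by (simp add: eventually_primepow_at_top)

lemma eventually_primepow_at_topI: "eventually P at_top \<Longrightarrow> eventually P primepow_at_top"
  by (auto simp: eventually_primepow_at_top elim: eventually_mono)

lemma aas_mono:
  assumes "aas M E"
    and "\<forall>\<^sub>F q in primepow_at_top. measure_pmf.prob (M q) {x. E q x} \<le> measure_pmf.prob (M' q) {x. E' q x}"
  shows "aas M' E'"
  unfolding aas_def
proof (rule tendsto_sandwich[where h = "\<lambda>_. 1", OF assms(2)])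
  show "((\<lambda>q. measure_pmf.prob (M q) {x. E q x}) \<longlongrightarrow> 1) primepow_at_top"
    using assms(1) by (simp add: aas_def)
qed (auto intro: always_eventually)

lemma aasI:
  assumes "\<forall>\<^sub>F q in primepow_at_top. measure_pmf.prob (M q) {x. \<not> E q x} \<le> b q"
    and "(b \<longlongrightarrow> 0) primepow_at_top"
  shows "aas M E"
  unfolding aas_def
proof (rule tendsto_sandwich[where h = "\<lambda>_. 1"])
  show "\<forall>\<^sub>F q in primepow_at_top. 1 - b q \<le> measure_pmf.prob (M q) {x. E q x}"
    using assms(1)
  proof eventually_elim
    case (elim q)
    have "measure_pmf.prob (M q) {x. E q x} = 1 - measure_pmf.prob (M q) {x. \<not> E q x}"
      using measure_pmf.prob_compl[of "{x. \<not> E q x}" "M q"] by (simp add: Compl_eq_Diff_UNIV[symmetric] Collect_neg_eq[symmetric])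
    thus ?case using elim by simp
  qed
  show "((\<lambda>q. 1 - b q) \<longlongrightarrow> 1) primepow_at_top"
    using tendsto_diff[OF tendsto_const assms(2), of 1] by simp
qed (auto intro: always_eventually)

section \<open>The regimes of \<open>p\<close> for a family of fields\<close>

locale projective_space_family =
  fixes r :: nat and K :: "nat \<Rightarrow> 'a ring"
  assumes r_ge_3: "r \<ge> 3"
    and K: "\<And>q. primepow q \<Longrightarrow> field (K q) \<and> order (K q) = q"
begin

lemma finite_projective_space: "primepow q \<Longrightarrow> finite_projective_space (K q) q"
  using K primepow_gt_Suc_0[of q]
  by (auto simp: finite_projective_space_def finite_projective_space_axioms_def)

text \<open>The hypotheses on \<open>p\<close> say exactly that the error parameters
  \<open>z\<close> and \<open>w\<close> of the deviation bound tend to 0.\<close>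

lemma aas_sparse:
  assumes p: "prob_function p" and lo: "(\<lambda>q. real q powr (- real r)) \<lless> p"
    and hi: "p \<lless> (\<lambda>q. real q powr (- (real r + 1) / 2))"
  shows "\<exists>\<delta>. (\<delta> \<longlongrightarrow> 0) primepow_at_top \<and>
    aas (\<lambda>q. random_collinear_triples (K q) r (p q))
      (\<lambda>q H. \<bar>real (independence_number H) - p q * real q ^ r\<bar> \<le> \<delta> q * (p q * real q ^ r))"
proof -
  let ?F = primepow_at_top
  define z where "z q = 1 / (p q * real q ^ r)" for q
  define w where "w q = (p q)\<^sup>2 * real q ^ (r + 1)" for q
  have q0: "\<forall>\<^sub>F q in ?F. real q > 0"
    by (intro eventually_primepow_at_topI) real_asymp
  have "\<forall>\<^sub>F q in ?F. norm (real q powr (- real r)) \<le> 1 * norm (p q)"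
    by (rule landau_o.smallD[OF lo[unfolded much_less_def]]) simp
  hence p_pos: "\<forall>\<^sub>F q in ?F. 0 < p q \<and> p q \<le> 1"
    using q0 eventually_primepow
  proof eventually_elim
    case (elim q)
    have "real q powr (- real r) > 0" using elim by simp
    hence "p q \<noteq> 0" using elim by auto
    moreover have "0 \<le> p q" "p q \<le> 1"
      using p elim(3) by (simp_all add: prob_function_def)
    ultimately show ?case by simp
  qed
  have z: "(z \<longlongrightarrow> 0) ?F"
  proof (rule Lim_transform_eventually)
    show "((\<lambda>q. real q powr (- real r) / p q) \<longlongrightarrow> 0) ?F"
      using lo unfolding much_less_def by (rule smalloD_tendsto)
    show "\<forall>\<^sub>F q in ?F. real q powr (- real r) / p q = z q"
      using q0 by eventually_elim (simp add: z_def powr_minus powr_realpow field_simps)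
  qed
  have w: "(w \<longlongrightarrow> 0) ?F"
  proof (rule Lim_transform_eventually)
    have "((\<lambda>q. p q / real q powr (- (real r + 1) / 2)) \<longlongrightarrow> 0) ?F"
      using hi unfolding much_less_def by (rule smalloD_tendsto)
    thus "((\<lambda>q. (p q / real q powr (- (real r + 1) / 2)) ^ 2) \<longlongrightarrow> 0) ?F"
      by (auto intro!: tendsto_eq_intros)
    show "\<forall>\<^sub>F q in ?F. (p q / real q powr (- (real r + 1) / 2)) ^ 2 = w q"
      using q0
    proof eventually_elim
      case (elim q)
      have "(real q powr (- (real r + 1) / 2)) ^ 2 = real q powr (- (real r + 1))"
        using elim by (simp add: power2_eq_square flip: powr_add)
      also have "\<dots> = 1 / real q ^ (r + 1)"
        using elim powr_realpow[of "real q" "r + 1"] powr_minus[of "real q" "real r + 1"]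
        by (simp add: field_simps del: power_Suc)
      finally show ?case by (simp add: w_def power_divide)
    qed
  qed
  \<comment> \<open>The errors are of the form \<open>z / \<epsilon>^2\<close> and
    \<open>w / \<epsilon>\<close>. Taking the fourth root of \<open>z\<close> plus the square root
    of \<open>w\<close> keeps them below \<open>sqrt z\<close> and \<open>sqrt w\<close> while
    \<open>\<epsilon>\<close> still tends to 0.\<close>
  define \<epsilon> where "\<epsilon> q = sqrt (sqrt (z q)) + sqrt (w q)" for q
  have \<epsilon>: "(\<epsilon> \<longlongrightarrow> 0) ?F"
    unfolding \<epsilon>_def using tendsto_add[OF tendsto_real_sqrt[OF tendsto_real_sqrt[OF z]] tendsto_real_sqrt[OF w]] by simp
  have inv: "((\<lambda>q. 2 / real q) \<longlongrightarrow> 0) ?F"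
    by (intro tendsto_primepow_at_top) real_asymp
  show ?thesis
  proof (intro exI[of _ "\<lambda>q. 4 * \<epsilon> q + 2 / real q"] conjI)
    show "((\<lambda>q. 4 * \<epsilon> q + 2 / real q) \<longlongrightarrow> 0) ?F"
      using tendsto_add[OF tendsto_mult[OF tendsto_const \<epsilon>, of 4] inv] by simp
    show "aas (\<lambda>q. random_collinear_triples (K q) r (p q))
      (\<lambda>q H. \<bar>real (independence_number H) - p q * real q ^ r\<bar> \<le> (4 * \<epsilon> q + 2 / real q) * (p q * real q ^ r))"
    proof (rule aasI)
      show "((\<lambda>q. sqrt (z q) + 4 * sqrt (w q)) \<longlongrightarrow> 0) ?F"
        using tendsto_add[OF tendsto_real_sqrt[OF z] tendsto_mult[OF tendsto_const tendsto_real_sqrt[OF w], of 4]] by simp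
      show "\<forall>\<^sub>F q in ?F. measure_pmf.prob (random_collinear_triples (K q) r (p q))
          {H. \<not> \<bar>real (independence_number H) - p q * real q ^ r\<bar> \<le> (4 * \<epsilon> q + 2 / real q) * (p q * real q ^ r)}
          \<le> sqrt (z q) + 4 * sqrt (w q)"
        using q0 p_pos eventually_primepow
      proof eventually_elim
        case (elim q)
        interpret finite_projective_space "K q" r q by (rule finite_projective_space[OF elim(3)])
        have z0: "z q > 0" and w0: "w q > 0" using elim by (auto simp: z_def w_def)
        have e: "sqrt (sqrt (z q)) \<le> \<epsilon> q" "sqrt (w q) \<le> \<epsilon> q" "\<epsilon> q > 0"
          using z0 w0 by (auto simp: \<epsilon>_def add_pos_pos)
        have "measure_pmf.prob (random_collinear_triples (K q) r (p q))
          {H. \<not> \<bar>real (independence_number H) - p q * real q ^ r\<bar> \<le> (4 * \<epsilon> q + 2 / real q) * (p q * real q ^ r)}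
          \<le> 1 / ((\<epsilon> q)\<^sup>2 * (p q * real q ^ r)) + 4 * ((p q)\<^sup>2 * real q ^ (r + 1)) / \<epsilon> q"
          using elim e r_ge_3 by (intro prob_independence_number_deviation) auto
        also have "1 / ((\<epsilon> q)\<^sup>2 * (p q * real q ^ r)) = z q / (\<epsilon> q)\<^sup>2"
          by (simp add: z_def)
        also have "\<dots> \<le> z q / sqrt (z q)"
        proof -
          have "sqrt (z q) \<le> (\<epsilon> q)\<^sup>2"
            using power_mono[OF e(1), of 2] z0 by simp
          thus ?thesis using z0 e by (intro divide_left_mono) auto
        qed
        also have "\<dots> = sqrt (z q)" using z0 by (intro real_div_sqrt) simp
        also have "4 * ((p q)\<^sup>2 * real q ^ (r + 1)) / \<epsilon> q \<le> 4 * (w q / sqrt (w q))"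
          using divide_left_mono[OF e(2), of "w q"] w0 e by (simp add: w_def)
        also have "w q / sqrt (w q) = sqrt (w q)" using w0 by (intro real_div_sqrt) simp
        finally show ?case by simp
      qed
    qed
  qed
qed

text \<open>With \<open>y\<close> the squared logarithm, this matches the bounds of (b) and (c) at
  their common endpoint.\<close>

lemma powr_half_mult:
  fixes q :: nat and y :: real
  assumes "q > 0"
  shows "real q powr (- (real r - 1) / 2) * y * real q ^ (r - 1) = real q powr ((real r - 1) / 2) * y"
proof -
  have "real q ^ (r - 1) = real q powr (real r - 1)"
    using assms r_ge_3 powr_realpow[of "real q" "r - 1"] by (simp add: of_nat_diff)
  hence "real q powr (- (real r - 1) / 2) * real q ^ (r - 1) = real q powr ((real r - 1) / 2)"
    using assms by (simp flip: powr_add add: field_simps)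
  thus ?thesis by (metis mult.assoc mult.commute)
qed

lemma aas_le:
  assumes p: "prob_function p"
    and b: "\<forall>\<^sub>F q in primepow_at_top. p q * real q ^ (r - 1) \<le> b q"
      "\<forall>\<^sub>F q in primepow_at_top. real q powr ((real r - 1) / 2) * (ln (real q))\<^sup>2 \<le> b q"
  shows "aas (\<lambda>q. random_collinear_triples (K q) r (p q))
    (\<lambda>q H. real (independence_number H) \<le> (4 * real r + 29) * b q)"
proof (rule aasI)
  show "((\<lambda>q. 1 / real q) \<longlongrightarrow> 0) primepow_at_top"
    by (intro tendsto_primepow_at_top) real_asymp
  have q0: "\<forall>\<^sub>F q in primepow_at_top. 8 \<le> ln (real q) \<and> real q \<ge> 1"
    by (intro eventually_primepow_at_topI eventually_conj) real_asymp+
  show "\<forall>\<^sub>F q in primepow_at_top. measure_pmf.prob (random_collinear_triples (K q) r (p q))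
      {H. \<not> real (independence_number H) \<le> (4 * real r + 29) * b q} \<le> 1 / real q"
    using b q0 eventually_primepow
  proof eventually_elim
    case (elim q)
    interpret finite_projective_space "K q" r q by (rule finite_projective_space[OF elim(4)])
    have "measure_pmf.prob (random_collinear_triples (K q) r (p q))
        {H. \<not> real (independence_number H) \<le> (4 * real r + 29) * b q} \<le> exp (- b q)"
      using elim p r_ge_3 by (intro prob_independence_number_large) (auto simp: prob_function_def)
    also have "\<dots> \<le> exp (- ln (real q))"
    proof -
      \<comment> \<open>This yields \<open>ln q \<le> b q\<close>, so the failure probability
        \<open>exp (- b q)\<close> is at most \<open>1 / q\<close>.\<close>
      have "1 * (1 * ln (real q)) \<le> real q powr ((real r - 1) / 2) * (ln (real q) * ln (real q))"
        using elim r_ge_3 by (intro mult_mono ge_one_powr_ge_zero) auto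
      thus ?thesis using elim(2) by (simp add: power2_eq_square)
    qed
    also have "\<dots> = 1 / real q" using elim by (simp add: exp_minus field_simps)
    finally show ?case .
  qed
qed

text \<open>By monotonicity it is enough to treat the smallest admissible density, which lies in the
  sparse regime, where the independence number is about \<open>p q^r\<close>; an error below 1/2
  gives the constant.\<close>

lemma aas_ge:
  assumes p: "prob_function p"
    and lo: "\<forall>\<^sub>F q in primepow_at_top. real q powr (- (real r + 1) / 2) / ln (real q) \<le> p q"
  shows "aas (\<lambda>q. random_collinear_triples (K q) r (p q))
    (\<lambda>q H. 1 / 2 * (real q powr ((real r - 1) / 2) / ln (real q)) \<le> real (independence_number H))"
proof -
  let ?F = primepow_at_top
  define f where "f q = real q powr (- (real r + 1) / 2) / ln (real q)" for q :: nat
  \<comment> \<open>Eventually \<open>p0\<close> is \<open>f\<close>; the minimum keeps it a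
    probability below \<open>p\<close> at every prime power.\<close>
  define p0 where "p0 q = min (p q) (f q)" for q
  have q0: "\<forall>\<^sub>F q in ?F. ln (real q) > 0 \<and> real q \<ge> 1"
    by (intro eventually_primepow_at_topI eventually_conj) real_asymp+
  have p0_eq: "\<forall>\<^sub>F q in ?F. p0 q = f q"
    using lo by eventually_elim (simp add: p0_def f_def)
  have p0: "prob_function p0"
    using p primepow_gt_Suc_0 by (force simp: prob_function_def p0_def f_def min_def)
  have lo0: "(\<lambda>q. real q powr (- real r)) \<lless> p0"
    unfolding much_less_def
  proof (rule smalloI_tendsto)
    show "\<forall>\<^sub>F q in ?F. p0 q \<noteq> 0"
      using p0_eq q0 by eventually_elim (auto simp: f_def)
    show "((\<lambda>q. real q powr (- real r) / p0 q) \<longlongrightarrow> 0) ?F"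
    proof (rule tendsto_sandwich[where f = "\<lambda>_. 0"])
      show "((\<lambda>q. ln (real q) / real q) \<longlongrightarrow> 0) ?F"
        by (intro tendsto_primepow_at_top) real_asymp
      show "\<forall>\<^sub>F q in ?F. 0 \<le> real q powr (- real r) / p0 q"
        using p0_eq q0 by eventually_elim (auto simp: f_def)
      show "\<forall>\<^sub>F q in ?F. real q powr (- real r) / p0 q \<le> ln (real q) / real q"
        using p0_eq q0
      proof eventually_elim
        case (elim q)
        have "real q powr (- real r) / p0 q =
            real q powr (- real r) / real q powr (- (real r + 1) / 2) * ln (real q)"
          using elim by (simp add: f_def)
        \<comment> \<open>The exponent is \<open>-r + (r+1)/2 = -(r-1)/2\<close>, which is at most
          -1 because \<open>r \<ge> 3\<close>.\<close>
        also have "real q powr (- real r) / real q powr (- (real r + 1) / 2) = real q powr (- ((real r - 1) / 2))"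
          unfolding powr_diff[symmetric] by (rule arg_cong[where f = "\<lambda>e. real q powr e"]) (simp add: field_simps)
        also have "\<dots> \<le> real q powr (- 1)"
          using elim r_ge_3 by (intro powr_mono) auto
        also have "real q powr (- 1) = 1 / real q"
          using elim by (simp add: powr_minus field_simps)
        finally show ?case using elim by (simp add: mult_right_mono)
      qed
    qed auto
  qed
  have hi0: "p0 \<lless> (\<lambda>q. real q powr (- (real r + 1) / 2))"
    unfolding much_less_def
  proof (rule smalloI_tendsto)
    show "\<forall>\<^sub>F q in ?F. real q powr (- (real r + 1) / 2) \<noteq> 0"
      using q0 by eventually_elim auto
    show "((\<lambda>q. p0 q / real q powr (- (real r + 1) / 2)) \<longlongrightarrow> 0) ?F"
    proof (rule Lim_transform_eventually)
      show "((\<lambda>q. 1 / ln (real q)) \<longlongrightarrow> 0) ?F"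
        by (intro tendsto_primepow_at_top) real_asymp
      show "\<forall>\<^sub>F q in ?F. 1 / ln (real q) = p0 q / real q powr (- (real r + 1) / 2)"
        using p0_eq q0 by eventually_elim (auto simp: f_def)
    qed
  qed
  obtain \<delta> where \<delta>: "(\<delta> \<longlongrightarrow> 0) ?F"
    and aas0: "aas (\<lambda>q. random_collinear_triples (K q) r (p0 q))
      (\<lambda>q H. \<bar>real (independence_number H) - p0 q * real q ^ r\<bar> \<le> \<delta> q * (p0 q * real q ^ r))"
    using aas_sparse[OF p0 lo0 hi0] by blast
  have \<delta>2: "\<forall>\<^sub>F q in ?F. \<delta> q < 1 / 2"
    using \<delta> by (rule order_tendstoD) simp
  from aas0 show ?thesis
  proof (rule aas_mono)
    show "\<forall>\<^sub>F q in ?F. measure_pmf.prob (random_collinear_triples (K q) r (p0 q))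
        {H. \<bar>real (independence_number H) - p0 q * real q ^ r\<bar> \<le> \<delta> q * (p0 q * real q ^ r)}
      \<le> measure_pmf.prob (random_collinear_triples (K q) r (p q))
        {H. 1 / 2 * (real q powr ((real r - 1) / 2) / ln (real q)) \<le> real (independence_number H)}"
      using \<delta>2 p0_eq q0 eventually_primepow
    proof eventually_elim
      case (elim q)
      interpret finite_projective_space "K q" r q by (rule finite_projective_space[OF elim(4)])
      let ?x = "1 / 2 * (real q powr ((real r - 1) / 2) / ln (real q))"
      have "real q ^ r = real q powr real r" using elim by (simp add: powr_realpow)
      hence "real q powr (- (real r + 1) / 2) * real q ^ r = real q powr ((real r - 1) / 2)"
        using elim by (simp flip: powr_add add: field_simps)
      hence x: "?x = 1 / 2 * (p0 q * real q ^ r)"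
        using elim(2) by (simp add: f_def)
      have p0x: "0 \<le> p0 q * real q ^ r" using elim by (simp add: f_def)
      have "measure_pmf.prob (random_collinear_triples (K q) r (p0 q))
        {H. \<bar>real (independence_number H) - p0 q * real q ^ r\<bar> \<le> \<delta> q * (p0 q * real q ^ r)}
        \<le> measure_pmf.prob (random_collinear_triples (K q) r (p0 q)) {H. ?x \<le> real (independence_number H)}"
      proof (intro measure_pmf.finite_measure_mono subsetI)
        fix H :: "(nat \<Rightarrow> 'a) set hypergraph"
        assume H: "H \<in> {H. \<bar>real (independence_number H) - p0 q * real q ^ r\<bar> \<le> \<delta> q * (p0 q * real q ^ r)}"
        have "\<delta> q * (p0 q * real q ^ r) \<le> 1 / 2 * (p0 q * real q ^ r)"
          using elim(1) p0x by (intro mult_right_mono) auto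
        thus "H \<in> {H. ?x \<le> real (independence_number H)}" using H unfolding x by auto
      qed auto
      also have "\<dots> \<le> measure_pmf.prob (random_collinear_triples (K q) r (p q)) {H. ?x \<le> real (independence_number H)}"
        using p p0 elim(4) by (intro prob_independence_number_mono) (auto simp: prob_function_def p0_def)
      finally show ?case .
    qed
  qed
qed

text \<open>Eventually \<open>p \<ge> 1 / q\<close>, so the quadric is expected to contain at least
  about \<open>q\<close> chosen points and the Chebyshev error is at most
  \<open>4 / q\<close>.\<close>

lemma aas_ge_quadric:
  assumes "r = 3" and p: "prob_function p"
    and lo: "(\<lambda>q. real q powr (- (real r - 1) / 2) * ln (real q)) \<lless> p"
  shows "aas (\<lambda>q. random_collinear_triples (K q) r (p q))
    (\<lambda>q H. 1 / 2 * (p q * real q ^ (r - 1)) \<le> real (independence_number H))"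
proof (rule aasI)
  show "((\<lambda>q. 4 / real q) \<longlongrightarrow> 0) primepow_at_top"
    by (intro tendsto_primepow_at_top) real_asymp
  have q0: "\<forall>\<^sub>F q in primepow_at_top. 1 \<le> ln (real q) \<and> real q \<ge> 1"
    by (intro eventually_primepow_at_topI eventually_conj) real_asymp+
  have "\<forall>\<^sub>F q in primepow_at_top. norm (real q powr (- (real r - 1) / 2) * ln (real q)) \<le> 1 * norm (p q)"
    by (rule landau_o.smallD[OF lo[unfolded much_less_def]]) simp
  thus "\<forall>\<^sub>F q in primepow_at_top. measure_pmf.prob (random_collinear_triples (K q) r (p q))
      {H. \<not> 1 / 2 * (p q * real q ^ (r - 1)) \<le> real (independence_number H)} \<le> 4 / real q"
    using q0 eventually_primepow
  proof eventually_elim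
    case (elim q)
    interpret finite_projective_space "K q" r q by (rule finite_projective_space[OF elim(3)])
    have p01: "0 \<le> p q" "p q \<le> 1" using p elim(3) by (auto simp: prob_function_def)
    have "real q powr (- 1) * 1 \<le> real q powr (- 1) * ln (real q)"
      using elim by (intro mult_left_mono) auto
    also have "\<dots> \<le> p q" using elim(1,2) p01 \<open>r = 3\<close> by simp
    finally have "1 / real q \<le> p q" using elim by (simp add: powr_minus field_simps)
    hence pq: "1 \<le> p q * real q" and p0: "0 < p q" using elim(2) p01 
      by (auto simp: field_simps less_le)
    have "real q * 1 \<le> real q * (p q * real q)" using pq elim(2) by (intro mult_left_mono) auto
    hence big: "real q \<le> p q * real q ^ 2" by (simp add: power2_eq_square mult_ac)
    have "measure_pmf.prob (random_collinear_triples (K q) r (p q))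
      {H. \<not> 1 / 2 * (p q * real q ^ (r - 1)) \<le> real (independence_number H)} \<le> 4 / (p q * real q ^ 2)"
      using prob_independence_number_quadric[OF assms(1) p0 p01(2)] assms(1) by simp
    also have "\<dots> \<le> 4 / real q" using big elim(2) by (intro divide_left_mono) auto
    finally show ?case .
  qed
qed

end

theorem theorem3p7:
  fixes r :: nat and K :: "nat \<Rightarrow> 'a ring"
  assumes r: "r \<ge> 3"
    and K: "\<And>q. primepow q \<Longrightarrow> field (K q) \<and> order (K q) = q"
  defines "\<H> \<equiv> \<lambda>p q. random_collinear_triples (K q) r (p q)"
    and "\<alpha> \<equiv> \<lambda>H. real (independence_number (H :: (nat \<Rightarrow> 'a) set hypergraph))"
  shows
    "(\<forall>p. prob_function p \<and>
          (\<lambda>q. real q powr (- real r)) \<lless> p \<and> p \<lless> (\<lambda>q. real q powr (- (real r + 1) / 2)) \<longrightarrow>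
          (\<exists>\<delta>. (\<delta> \<longlongrightarrow> 0) primepow_at_top \<and>
               aas (\<H> p) (\<lambda>q H. \<bar>\<alpha> H - p q * real q ^ r\<bar> \<le> \<delta> q * (p q * real q ^ r))))
     \<and>
     (\<exists>C>0. \<forall>p. prob_function p \<and>
          (\<forall>\<^sub>F q in primepow_at_top.
              real q powr (- (real r + 1) / 2) \<le> p q \<and>
              p q \<le> real q powr (- (real r - 1) / 2) * (ln (real q))\<^sup>2) \<longrightarrow>
          aas (\<H> p) (\<lambda>q H. \<alpha> H \<le> C * (real q powr ((real r - 1) / 2) * (ln (real q))\<^sup>2)))
     \<and>
     (\<exists>C>0. \<forall>p. prob_function p \<and>
          (\<forall>\<^sub>F q in primepow_at_top.
              real q powr (- (real r - 1) / 2) * (ln (real q))\<^sup>2 \<le> p q \<and> p q \<le> 1) \<longrightarrow>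
          aas (\<H> p) (\<lambda>q H. \<alpha> H \<le> C * (p q * real q ^ (r - 1))))
     \<and>
     (\<exists>c>0. \<forall>p. prob_function p \<and>
          (\<forall>\<^sub>F q in primepow_at_top.
              real q powr (- (real r + 1) / 2) / ln (real q) \<le> p q \<and> p q \<le> 1) \<longrightarrow>
          aas (\<H> p) (\<lambda>q H. \<alpha> H \<ge> c * (real q powr ((real r - 1) / 2) / ln (real q))))
     \<and>
     (r = 3 \<longrightarrow>
      (\<exists>c>0. \<forall>p. prob_function p \<and>
          (\<lambda>q. real q powr (- (real r - 1) / 2) * ln (real q)) \<lless> p \<and>
          (\<forall>\<^sub>F q in primepow_at_top. p q \<le> 1) \<longrightarrow>
          aas (\<H> p) (\<lambda>q H. \<alpha> H \<ge> c * (p q * real q ^ (r - 1)))))"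
proof -
  interpret projective_space_family r K by unfold_locales (use r K in auto)
  have q0: "\<forall>\<^sub>F q in primepow_at_top. real q > 0"
    by (intro eventually_primepow_at_topI) real_asymp
  show ?thesis
    unfolding \<H>_def \<alpha>_def
  proof (intro conjI allI impI)
    fix p :: "nat \<Rightarrow> real"
    assume "prob_function p \<and> (\<lambda>q. real q powr (- real r)) \<lless> p \<and> p \<lless> (\<lambda>q. real q powr (- (real r + 1) / 2))"
    thus "\<exists>\<delta>. (\<delta> \<longlongrightarrow> 0) primepow_at_top \<and> aas (\<lambda>q. random_collinear_triples (K q) r (p q))
        (\<lambda>q H. \<bar>real (independence_number H) - p q * real q ^ r\<bar> \<le> \<delta> q * (p q * real q ^ r))"
      by (intro aas_sparse) auto
  next
    show "\<exists>C>0. \<forall>p. prob_function p \<and>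
          (\<forall>\<^sub>F q in primepow_at_top.
              real q powr (- (real r + 1) / 2) \<le> p q \<and>
              p q \<le> real q powr (- (real r - 1) / 2) * (ln (real q))\<^sup>2) \<longrightarrow>
          aas (\<lambda>q. random_collinear_triples (K q) r (p q))
            (\<lambda>q H. real (independence_number H) \<le> C * (real q powr ((real r - 1) / 2) * (ln (real q))\<^sup>2))"
    proof (intro exI[of _ "4 * real r + 29"] conjI allI impI)
      fix p :: "nat \<Rightarrow> real"
      assume A: "prob_function p \<and>
          (\<forall>\<^sub>F q in primepow_at_top.
              real q powr (- (real r + 1) / 2) \<le> p q \<and>
              p q \<le> real q powr (- (real r - 1) / 2) * (ln (real q))\<^sup>2)"
      show "aas (\<lambda>q. random_collinear_triples (K q) r (p q))
            (\<lambda>q H. real (independence_number H) \<le> (4 * real r + 29) * (real q powr ((real r - 1) / 2) * (ln (real q))\<^sup>2))"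
      \<comment> \<open>\<open>b\<close> is the claimed bound itself; the upper limit on
        \<open>p\<close> gives \<open>p q^(r-1) \<le> b\<close>.\<close>
      proof (rule aas_le)
        from A have "\<forall>\<^sub>F q in primepow_at_top.
              real q powr (- (real r + 1) / 2) \<le> p q \<and>
              p q \<le> real q powr (- (real r - 1) / 2) * (ln (real q))\<^sup>2" by blast
        thus "\<forall>\<^sub>F q in primepow_at_top. p q * real q ^ (r - 1) \<le> real q powr ((real r - 1) / 2) * (ln (real q))\<^sup>2"
          using q0
        proof eventually_elim
          case (elim q)
          hence "p q * real q ^ (r - 1) \<le> real q powr (- (real r - 1) / 2) * (ln (real q))\<^sup>2 * real q ^ (r - 1)"
            by (intro mult_right_mono) auto
          also have "\<dots> = real q powr ((real r - 1) / 2) * (ln (real q))\<^sup>2"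
            using elim(2) by (intro powr_half_mult) simp
          finally show ?case .
        qed
      qed (use A in auto)
    qed auto
  next
    show "\<exists>C>0. \<forall>p. prob_function p \<and>
          (\<forall>\<^sub>F q in primepow_at_top.
              real q powr (- (real r - 1) / 2) * (ln (real q))\<^sup>2 \<le> p q \<and> p q \<le> 1) \<longrightarrow>
          aas (\<lambda>q. random_collinear_triples (K q) r (p q))
            (\<lambda>q H. real (independence_number H) \<le> C * (p q * real q ^ (r - 1)))"
    proof (intro exI[of _ "4 * real r + 29"] conjI allI impI)
      fix p :: "nat \<Rightarrow> real"
      assume A: "prob_function p \<and>
          (\<forall>\<^sub>F q in primepow_at_top.
              real q powr (- (real r - 1) / 2) * (ln (real q))\<^sup>2 \<le> p q \<and> p q \<le> 1)"
      show "aas (\<lambda>q. random_collinear_triples (K q) r (p q))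
            (\<lambda>q H. real (independence_number H) \<le> (4 * real r + 29) * (p q * real q ^ (r - 1)))"
      \<comment> \<open>Now \<open>b\<close> is \<open>p q^(r-1)\<close>, and the lower limit on
        \<open>p\<close> makes it dominate the other term.\<close>
      proof (rule aas_le)
        from A have "\<forall>\<^sub>F q in primepow_at_top.
              real q powr (- (real r - 1) / 2) * (ln (real q))\<^sup>2 \<le> p q \<and> p q \<le> 1" by blast
        thus "\<forall>\<^sub>F q in primepow_at_top. real q powr ((real r - 1) / 2) * (ln (real q))\<^sup>2 \<le> p q * real q ^ (r - 1)"
          using q0
        proof eventually_elim
          case (elim q)
          have "real q powr ((real r - 1) / 2) * (ln (real q))\<^sup>2 =
              real q powr (- (real r - 1) / 2) * (ln (real q))\<^sup>2 * real q ^ (r - 1)"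
            using elim(2) by (intro powr_half_mult[symmetric]) simp
          also have "\<dots> \<le> p q * real q ^ (r - 1)"
            using elim(1) by (intro mult_right_mono) auto
          finally show ?case .
        qed
      qed (use A in auto)
    qed auto
  next
    show "\<exists>c>0. \<forall>p. prob_function p \<and>
          (\<forall>\<^sub>F q in primepow_at_top.
              real q powr (- (real r + 1) / 2) / ln (real q) \<le> p q \<and> p q \<le> 1) \<longrightarrow>
          aas (\<lambda>q. random_collinear_triples (K q) r (p q))
            (\<lambda>q H. c * (real q powr ((real r - 1) / 2) / ln (real q)) \<le> real (independence_number H))"
      by (intro exI[of _ "1 / 2"] conjI allI impI aas_ge) (auto elim: eventually_mono)
  next
    assume "r = 3"
    thus "\<exists>c>0. \<forall>p. prob_function p \<and>
          (\<lambda>q. real q powr (- (real r - 1) / 2) * ln (real q)) \<lless> p \<and>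
          (\<forall>\<^sub>F q in primepow_at_top. p q \<le> 1) \<longrightarrow>
          aas (\<lambda>q. random_collinear_triples (K q) r (p q))
            (\<lambda>q H. c * (p q * real q ^ (r - 1)) \<le> real (independence_number H))"
      by (intro exI[of _ "1 / 2"] conjI allI impI aas_ge_quadric) auto
  qed
qed

end
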